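(* Let $(\Gamma_h)_{h>0}$ be a family of isoradial graphs, and suppose there exist constants $c_p,c_d>0$ such that for all $h>0$ $$c_p h\le \inf_{e\in E_h}|e| \qquad\text{and}\qquad c_d h\le \inf_{e^*\in E_h^*}|e^*| .$$ Let $p^h$ be the discrete heat kernel and $d_h$ the combinatorial graph distance of $\Gamma_h$, both extended to $\mathbb{C}\times\mathbb{C}$ by projection to the closest vertex. Fix $x,y\in\mathbb{C}$. Then for all $\beta>1$ and $t>0$, $$\lim_{h\to0}\left[\frac{h}{\log h^{\beta-1}}\log p^h_{h^\beta t}(x,y)-h\,d_h(x,y)\right]=0 .$$
   Context: For each $h>0$, $\Gamma_h$ is an infinite planar graph embedded in $\mathbb{C}$ with straight edges, with vertex set $V_h$, edge set $E_h$ and face set $F_h$; it is locally finite (bounded sets contain finitely many vertices) and its (bounded, polygonal) faces tile the plane. $v\sim u$ means $\{v,u\}\in E_h$. $\Gamma_h$ is isoradial: each face $f\in F_h$ is inscribed in a circle of diameter $h$ whose center $m_f$ lies inside $f$. The dual graph $\Gamma_h^*$ has vertex set $V_h^*=\{m_f: f\in F_h\}$, with $m_f,m_g$ joined by a straight edge iff $f,g$ are adjacent; $E_h^*$ is its edge set. For $e\in E_h$, $e^*\in E_h^*$ is the dual edge joining the circumcenters of the two faces sharing $e$. $|e|,|e^*|$ denote Euclidean lengths. For $u\in V_h$, the dual face $D_u$ of $u$ is the polygon containing $u$ bounded by the dual edges $e^*$ of the edges $e$ incident to $u$; $A_u$ is its area. Edge weights: $\omega_{uv}=|e^*|/|e|$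 for $e=\{u,v\}\in E_h$. Vertex weights: $m_u=\sum_{z\sim u}\omega_{uz}$. The geometric graph Laplacian is $(\Delta_h f)(u)=\frac1{A_u}\sum_{v\sim u}\omega_{uv}(f(v)-f(u))$ for $f:V_h\to\mathbb{C}$. $X^h=(X^h_t)_{t\ge0}$ is the continuous-time random walk on $V_h$ with generator $\frac12\Delta_h$: it stays at $u$ for an exponential time of rate $\frac{m_u}{2A_u}$ and then jumps to $v\sim u$ with probability $\omega_{uv}/m_u$. $\mathbb{P}_u$ is its law when started at $u$. The discrete heat kernel is $p^h_t(u,v)=\mathbb{P}_u[X^h_t=v]/A_v$ for $u,v\in V_h$, $t\ge0$. The combinatorial distance $d_h(u,v)$ is the minimal number of edges of a path in $\Gamma_h$ from $u$ to $v$. For $x,y\in\mathbb{C}$, $p^h_t(x,y):=p^h_t(\pi_{V_h}(x),\pi_{V_h}(y))$ and $d_h(x,y):=d_h(\pi_{V_h}(x),\pi_{V_h}(y))$, where $\pi_{V_h}$ maps a point to a closest vertex in Euclidean distance (with some fixed choice in case of ties). *)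

theory Defs
  imports "HOL-Probability.Probability"
begin

text \<open>Vertices are points of the plane; an edge is the two-element set of its endpoints and is
  drawn as the segment \<^term>\<open>convex hull e\<close>.\<close>

record plane_graph =
  verts :: "complex set"
  edges :: "complex set set"

definition skeleton :: "plane_graph \<Rightarrow> complex set" where
  "skeleton G = verts G \<union> (\<Union>e\<in>edges G. convex hull e)"

text \<open>Faces are open sets; the corresponding closed tile is the closure.\<close>

definition faces :: "plane_graph \<Rightarrow> complex set set" where
  "faces G = components (- skeleton G)"

definition embedded_graph :: "plane_graph \<Rightarrow> bool" where
  "embedded_graph G \<longleftrightarrow>
     (\<forall>e\<in>edges G. \<exists>u\<in>verts G. \<exists>v\<in>verts G. u \<noteq> v \<and> e = {u, v}) \<and>
     (\<forall>e\<in>edges G. convex hull e \<inter> verts G = e) \<and>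
     (\<forall>e\<in>edges G. \<forall>e'\<in>edges G. e \<noteq> e' \<longrightarrow> convex hull e \<inter> convex hull e' = e \<inter> e')"

definition locally_finite_graph :: "plane_graph \<Rightarrow> bool" where
  "locally_finite_graph G \<longleftrightarrow> (\<forall>B. bounded B \<longrightarrow> finite (verts G \<inter> B))"

text \<open>The boundary of the face is a closed polygon through the distinct vertices
  \<open>vs\<close>; it is simple because the graph is embedded.\<close>

definition polygonal_face :: "plane_graph \<Rightarrow> complex set \<Rightarrow> bool" where
  "polygonal_face G f \<longleftrightarrow>
     (\<exists>vs. length vs \<ge> 3 \<and> distinct vs \<and>
        (\<forall>i<length vs. {vs ! i, vs ! (Suc i mod length vs)} \<in> edges G) \<and>
        frontier f = (\<Union>i<length vs. closed_segment (vs ! i) (vs ! (Suc i mod length vs))))"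

definition face_verts :: "plane_graph \<Rightarrow> complex set \<Rightarrow> complex set" where
  "face_verts G f = verts G \<inter> frontier f"

text \<open>The parameter \<open>h\<close> is the diameter, not the radius, of the circumscribed circles.\<close>

definition isoradial_graph :: "real \<Rightarrow> plane_graph \<Rightarrow> bool" where
  "isoradial_graph h G \<longleftrightarrow>
     infinite (verts G) \<and> embedded_graph G \<and> locally_finite_graph G \<and>
     (\<Union>f\<in>faces G. closure f) = UNIV \<and>
     (\<forall>f\<in>faces G. bounded f \<and> polygonal_face G f \<and>
        (\<exists>m\<in>f. face_verts G f \<subseteq> sphere m (h / 2)))"

definition circumcenter :: "plane_graph \<Rightarrow> complex set \<Rightarrow> complex" where
  "circumcenter G f = (THE m. \<exists>r. face_verts G f \<subseteq> sphere m r)"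

definition adjacent_faces :: "plane_graph \<Rightarrow> complex set \<Rightarrow> complex set \<Rightarrow> bool" where
  "adjacent_faces G f g \<longleftrightarrow>
     f \<noteq> g \<and> (\<exists>e\<in>edges G. convex hull e \<subseteq> frontier f \<and> convex hull e \<subseteq> frontier g)"

definition dual_edges :: "plane_graph \<Rightarrow> complex set set" where
  "dual_edges G = {{circumcenter G f, circumcenter G g} | f g.
     f \<in> faces G \<and> g \<in> faces G \<and> adjacent_faces G f g}"

definition dual_edge :: "plane_graph \<Rightarrow> complex set \<Rightarrow> complex set" where
  "dual_edge G e = circumcenter G ` {f \<in> faces G. convex hull e \<subseteq> frontier f}"

text \<open>For a two-element set the diameter is the distance of the two points.\<close>

definition edge_length :: "complex set \<Rightarrow> real" where
  "edge_length e = diameter e"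

definition dual_face :: "plane_graph \<Rightarrow> complex \<Rightarrow> complex set" where
  "dual_face G u =
     connected_component_set (- (\<Union>e\<in>{e \<in> edges G. u \<in> e}. convex hull (dual_edge G e))) u"

definition dual_area :: "plane_graph \<Rightarrow> complex \<Rightarrow> real" where
  "dual_area G u = measure lebesgue (dual_face G u)"

definition edge_weight :: "plane_graph \<Rightarrow> complex \<Rightarrow> complex \<Rightarrow> real" where
  "edge_weight G u v = edge_length (dual_edge G {u, v}) / edge_length {u, v}"

definition vertex_weight :: "plane_graph \<Rightarrow> complex \<Rightarrow> real" where
  "vertex_weight G u = (\<Sum>z | {u, z} \<in> edges G. edge_weight G u z)"

definition jump_rate :: "plane_graph \<Rightarrow> complex \<Rightarrow> real" where
  "jump_rate G u = vertex_weight G u / (2 * dual_area G u)"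

definition jump_pmf :: "plane_graph \<Rightarrow> complex \<Rightarrow> complex pmf" where
  "jump_pmf G u =
     embed_pmf (\<lambda>v. if {u, v} \<in> edges G then edge_weight G u v / vertex_weight G u else 0)"

text \<open>The continuous-time random walk is built from its jump chain and holding times. For all
  \<open>n\<close> and \<open>u\<close> the coordinate \<open>\<omega> (n, u)\<close> is an independent pair consisting of the vertex
  to which the walk jumps and of the exponential time it waits before, used if the
  chain is at \<open>u\<close> after \<open>n\<close> jumps.\<close>

definition walk_space :: "plane_graph \<Rightarrow> (nat \<times> complex \<Rightarrow> complex \<times> real) measure" where
  "walk_space G = PiM (UNIV \<times> verts G) (\<lambda>(n, u).
     measure_pmf (jump_pmf G u) \<Otimes>\<^sub>M
     density lborel (\<lambda>s. ennreal (exponential_density (jump_rate G u) s)))"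

primrec jump_chain :: "complex \<Rightarrow> (nat \<times> complex \<Rightarrow> complex \<times> real) \<Rightarrow> nat \<Rightarrow> complex" where
  "jump_chain u \<omega> 0 = u"
| "jump_chain u \<omega> (Suc n) = fst (\<omega> (n, jump_chain u \<omega> n))"

definition holding_time :: "complex \<Rightarrow> (nat \<times> complex \<Rightarrow> complex \<times> real) \<Rightarrow> nat \<Rightarrow> real" where
  "holding_time u \<omega> n = snd (\<omega> (n, jump_chain u \<omega> n))"

text \<open>The least \<open>n\<close> such that the first \<open>n + 1\<close> holding times add up to more than \<open>t\<close> is the
  number of jumps up to time \<open>t\<close>. Jump rates in the graphs considered are bounded, so
  it exists almost surely.\<close>

definition walk :: "complex \<Rightarrow> real \<Rightarrow> (nat \<times> complex \<Rightarrow> complex \<times> real) \<Rightarrow> complex" where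
  "walk u t \<omega> = jump_chain u \<omega> (LEAST n. t < (\<Sum>i\<le>n. holding_time u \<omega> i))"

definition heat_kernel :: "plane_graph \<Rightarrow> real \<Rightarrow> complex \<Rightarrow> complex \<Rightarrow> real" where
  "heat_kernel G t u v =
     measure (walk_space G) {\<omega> \<in> space (walk_space G). walk u t \<omega> = v} / dual_area G v"

text \<open>Isoradial graphs are connected, so the minimum below is over a nonempty set.\<close>

definition graph_dist :: "plane_graph \<Rightarrow> complex \<Rightarrow> complex \<Rightarrow> nat" where
  "graph_dist G u v = (LEAST n. \<exists>vs. length vs = Suc n \<and> hd vs = u \<and> last vs = v \<and>
     successively (\<lambda>a b. {a, b} \<in> edges G) vs)"

end

theory Submission
  imports Defs
begin

text \<open>Write \<open>d\<close> for the graph distance. To reach \<open>v\<close> from \<open>u\<close> in time \<open>s\<close> the walk has to jump at least \<open>d\<close>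
  times, and it may do so in exactly \<open>d\<close> jumps along a geodesic. If all jump rates are of order
  \<open>1 / h\<^sup>2\<close>, all jump probabilities are bounded below and the degrees are bounded, then both events have
  probability \<open>(s / (h\<^sup>2 d)) ^ d\<close> up to factors \<open>C ^ d\<close> and \<open>exp (C s / h\<^sup>2)\<close>. For \<open>s = h powr \<beta> * t\<close> and
  \<open>h d\<close> bounded this gives \<open>h ln p = h d (\<beta> - 1) ln h + O(1 + h \<bar>ln h\<bar>)\<close>, where \<open>h d ln (h d)\<close> is
  absorbed in the error because \<open>y ln y\<close> is bounded on bounded sets.

  The bounds on the walk come from the geometry. A face is connected, lies in its circumscribed disc
  and misses its sides, hence it is the intersection of the half-planes of its sides that contain
  the circumcentre. So every edge separates two faces whose centres are mirror images, and the
  triangles spanned by a vertex \<open>u\<close> and the dual edges around it fit together to a neighbourhood of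
  \<open>u\<close> that contains the dual face and no other vertex. This bounds the area of the dual face from
  both sides and separates the vertices by \<open>c\<^sub>p h / 2\<close>, after which packing bounds the degrees and
  the number of vertices near a segment, hence \<open>h d\<close>.\<close>

section \<open>Triangles and chords in the plane\<close>

text \<open>The definitions supply no cyclic order of the edges around a vertex, and the dual face
  is given only as a connected component, so nothing says in advance that it is bounded or a
  polygon. The proof never orders edges by angle. A face with corner \<open>u\<close> has two sides
  at \<open>u\<close>; the triangles over their dual edges share the segment from \<open>u\<close>
  to the centre of the face, and signs of the determinant \<open>cross\<close> show that they lie on
  opposite sides of it. This local gluing and a connectedness argument replace the angular order.
  Connectedness of the graph is not part of the definition either; it is derived from the covering
  of a segment by closed faces.

  The constant \<open>c\<^sub>d\<close> bounds the weights from below, and with them the rates and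
  the jump probabilities; \<open>c\<^sub>p\<close> bounds the weights from above and the dual areas
  from below. Bounded errors disappear in the limit because the normalisation divides them by a
  multiple of \<open>ln h\<close>.\<close>

definition cross :: "complex \<Rightarrow> complex \<Rightarrow> real" where
  "cross a b = Re a * Im b - Im a * Re b"

lemma cross_simps:
  "cross a a = 0" "cross 0 a = 0" "cross a 0 = 0"
  "cross a (b + c) = cross a b + cross a c" "cross a (b - c) = cross a b - cross a c"
  "cross (b + c) a = cross b a + cross c a" "cross (b - c) a = cross b a - cross c a"
  "cross a (r *\<^sub>R b) = r * cross a b" "cross (r *\<^sub>R a) b = r * cross a b"
  "cross (- a) b = - cross a b" "cross a (- b) = - cross a b"
  by (auto simp: cross_def algebra_simps)

lemma cross_linear_combination:
  "cross (a *\<^sub>R p + b *\<^sub>R q) q = a * cross p q" "cross p (a *\<^sub>R p + b *\<^sub>R q) = b * cross p q"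
  by (simp_all add: cross_simps)

lemma cross_commute: "cross a b = - cross b a"
  by (simp add: cross_def)

lemma continuous_on_cross [continuous_intros]:
  "continuous_on S f \<Longrightarrow> continuous_on S g \<Longrightarrow> continuous_on S (\<lambda>x. cross (f x) (g x))"
  unfolding cross_def by (intro continuous_intros)

lemma cross_eq_0D:
  assumes "cross a b = 0" "a \<noteq> 0"
  obtains s where "b = s *\<^sub>R a"
proof
  have n: "(Re a)\<^sup>2 + (Im a)\<^sup>2 \<noteq> 0"
    using assms(2) by (simp add: complex_eq_iff sum_power2_eq_zero_iff)
  show "b = (inner a b / inner a a) *\<^sub>R a"
    using assms(1) n
    by (simp add: complex_eq_iff inner_complex_def cross_def field_simps power2_eq_square)
qed

lemma cross_cramer:
  assumes "cross a b \<noteq> 0"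
  shows "x = (cross x b / cross a b) *\<^sub>R a + (cross a x / cross a b) *\<^sub>R b"
proof -
  have "cross a b *\<^sub>R x = cross x b *\<^sub>R a + cross a x *\<^sub>R b"
    by (simp add: complex_eq_iff cross_def algebra_simps)
  then have "x = (1 / cross a b) *\<^sub>R (cross x b *\<^sub>R a + cross a x *\<^sub>R b)"
    using assms by (metis divide_self_if scaleR_one scaleR_scaleR times_divide_eq_left mult_1)
  then show ?thesis by (simp add: scaleR_add_right)
qed

text \<open>Along the line through \<open>a\<close> and \<open>b\<close> the squared distance is a
  quadratic polynomial in \<open>s\<close> with leading coefficient
  \<open>(dist a b)\<^sup>2\<close> and value \<open>r\<^sup>2\<close> at \<open>s = 0\<close> and
  \<open>s = 1\<close>.\<close>

lemma dist_sq_chord: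
  fixes m a b :: complex
  assumes "dist m a = r" "dist m b = r"
  shows "(dist m (a + s *\<^sub>R (b - a)))\<^sup>2 = r\<^sup>2 + (s\<^sup>2 - s) * (dist a b)\<^sup>2"
proof -
  have "(dist m a)\<^sup>2 = r\<^sup>2" "(dist m b)\<^sup>2 = r\<^sup>2" using assms by simp_all
  then show ?thesis
    unfolding dist_norm cmod_power2 minus_complex.sel plus_complex.sel scaleR_complex.sel
    by algebra
qed

text \<open>Lying in the disc forces \<open>s * (s - 1) \<le> 0\<close> in the chord formula. This
  is what later confines a face to half-planes.\<close>

lemma chord_line_in_disc:
  assumes "dist m a = r" "dist m b = r" "a \<noteq> b" "dist m x \<le> r" "cross (b - a) (x - a) = 0"
  shows "x \<in> closed_segment a b"
proof -
  obtain s where s: "x - a = s *\<^sub>R (b - a)"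
    using cross_eq_0D[OF assms(5)] assms(3) by auto
  then have x: "x = a + s *\<^sub>R (b - a)" by (simp add: algebra_simps)
  have "(dist m x)\<^sup>2 \<le> r\<^sup>2" using assms(4) by (simp add: power_mono)
  then have "(s\<^sup>2 - s) * (dist a b)\<^sup>2 \<le> 0"
    using dist_sq_chord[OF assms(1,2), of s] x by simp
  then have "s * (s - 1) \<le> 0"
    using assms(3) by (simp add: mult_le_0_iff power2_eq_square right_diff_distrib)
  then have "0 \<le> s" "s \<le> 1" by (auto simp: mult_le_0_iff)
  then show ?thesis
    unfolding in_segment x by (intro exI[of _ s]) (simp add: algebra_simps)
qed

lemma dist_less_chord:
  fixes m a b :: complex
  assumes "dist m a = r" "dist m b = r" "x \<in> open_segment a b"
  shows "dist m x < r"
proof -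
  obtain s where s: "0 < s" "s < 1" "x = a + s *\<^sub>R (b - a)" and ab: "a \<noteq> b"
    using assms(3) unfolding in_segment by (auto simp: algebra_simps)
  have "s * s < s * 1" using s by (intro mult_strict_left_mono) auto
  then have "(s\<^sup>2 - s) * (dist a b)\<^sup>2 < 0" 
    using ab by (intro mult_neg_pos) (auto simp: power2_eq_square)
  then have "(dist m x)\<^sup>2 < r\<^sup>2"
    using dist_sq_chord[OF assms(1,2), of s] s by simp
  moreover have "0 \<le> r" using assms(1) by auto
  ultimately show ?thesis by (meson power2_less_imp_less)
qed

lemma circle_not_collinear:
  assumes "dist m a = r" "dist m b = r" "dist m c = r" "a \<noteq> b" "a \<noteq> c" "b \<noteq> c"
  shows "cross (b - a) (c - a) \<noteq> 0"
proof
  assume "cross (b - a) (c - a) = 0"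
  then have "c \<in> closed_segment a b" using chord_line_in_disc[of m a r b c] assms by simp
  then have "c \<in> open_segment a b" using assms by (simp add: open_segment_def)
  then show False using dist_less_chord[of m a r b c] assms by simp
qed

text \<open>Subtracting the equations of equal squared distances removes the quadratic terms and
  leaves, for the difference of the centres, a homogeneous linear system with determinant
  \<open>cross (b - a) (c - a)\<close>.\<close>

lemma circle_center_unique:
  fixes m m' :: complex
  assumes "dist m a = r" "dist m b = r" "dist m c = r" "a \<noteq> b" "a \<noteq> c" "b \<noteq> c"
    and "dist m' a = r'" "dist m' b = r'" "dist m' c = r'"
  shows "m = m'"
proof -
  have n: "cross (b - a) (c - a) \<noteq> 0" using circle_not_collinear assms by blast
  have 1: "(dist m a)\<^sup>2 = (dist m b)\<^sup>2" "(dist m a)\<^sup>2 = (dist m c)\<^sup>2"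
    "(dist m' a)\<^sup>2 = (dist m' b)\<^sup>2" "(dist m' a)\<^sup>2 = (dist m' c)\<^sup>2"
    using assms by simp_all
  have "cross (b - a) (c - a) * (Re m - Re m') = 0" "cross (b - a) (c - a) * (Im m - Im m') = 0"
    using 1 unfolding dist_norm cmod_power2 minus_complex.sel cross_def by algebra+
  then show ?thesis using n by (simp add: complex_eq_iff)
qed

text \<open>The vector \<open>?w\<close> is orthogonal to \<open>v - u\<close> and to
  \<open>m' - m\<close>. Centres on opposite sides of the chord make these two directions
  independent, so \<open>?w = 0\<close>.\<close>

lemma rhombus:
  fixes u v m m' :: complex
  assumes "dist m u = r" "dist m v = r" "dist m' u = r" "dist m' v = r"
    and "cross (v - u) (m - u) * cross (v - u) (m' - u) < 0"
  shows "m' = u + v - m"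
proof -
  let ?w = "m + m' - u - v"
  have 1: "(dist m u)\<^sup>2 = (dist m v)\<^sup>2" "(dist m' u)\<^sup>2 = (dist m' v)\<^sup>2" 
    "(dist m u)\<^sup>2 = (dist m' u)\<^sup>2"
    using assms by simp_all
  have uv: "u \<noteq> v" using assms(5) by (auto simp: cross_def)
  have neq: "cross (v - u) (m' - m) \<noteq> 0"
  proof
    assume "cross (v - u) (m' - m) = 0"
    then have "cross (v - u) (m' - u) = cross (v - u) (m - u)" by (simp add: cross_simps)
    then show False using assms(5) by (simp add: mult_less_0_iff)
  qed
  have i1: "(Re v - Re u) * Re ?w + (Im v - Im u) * Im ?w = 0"
    using 1(1,2) unfolding dist_norm cmod_power2 minus_complex.sel plus_complex.sel by algebra
  have i2: "(Re m' - Re m) * Re ?w + (Im m' - Im m) * Im ?w = 0"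
    using 1 unfolding dist_norm cmod_power2 minus_complex.sel plus_complex.sel by algebra
  have "cross (v - u) (m' - m) * Re ?w = 0" "cross (v - u) (m' - m) * Im ?w = 0"
    using i1 i2 unfolding cross_def minus_complex.sel plus_complex.sel by algebra+
  then have "?w = 0" using neq by (simp add: complex_eq_iff)
  then show ?thesis by (simp add: algebra_simps)
qed

text \<open>By Cramer's rule the barycentric coordinates are continuous in the point, so strict
  inequalities between them cut out an open part of the triangle.\<close>

lemma triangle_interior:
  assumes D: "cross (p - u) (q - u) \<noteq> 0" and ab: "0 < a" "0 < b" "a + b < 1"
  shows "u + a *\<^sub>R (p - u) + b *\<^sub>R (q - u) \<in> interior (convex hull {u, p, q})"
proof -
  let ?P = "p - u" and ?Q = "q - u"
  let ?a = "\<lambda>x. cross (x - u) ?Q / cross ?P ?Q" and ?b = "\<lambda>x. cross ?P (x - u) / cross ?P ?Q"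
  let ?W = "{x. 0 < ?a x} \<inter> {x. 0 < ?b x} \<inter> {x. ?a x + ?b x < 1}"
  have "open ?W"
    by (intro open_Int open_Collect_less continuous_intros) (simp_all add: D)
  moreover have "?W \<subseteq> convex hull {u, p, q}"
  proof
    fix x assume x: "x \<in> ?W"
    have "x = u + ?a x *\<^sub>R (p - u) + ?b x *\<^sub>R (q - u)"
      using cross_cramer[OF D, of "x - u"] by (simp add: add.assoc)
    then show "x \<in> convex hull {u, p, q}" unfolding convex_hull_3_alt
      using x by (intro CollectI exI[of _ "?a x"] exI[of _ "?b x"]) auto
  qed
  moreover have "u + a *\<^sub>R (p - u) + b *\<^sub>R (q - u) \<in> ?W"
  proof -
    let ?x = "u + a *\<^sub>R ?P + b *\<^sub>R ?Q"
    have e: "?x - u = a *\<^sub>R ?P + b *\<^sub>R ?Q" by simp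
    have "?a ?x = a" "?b ?x = b"
      using D by (simp_all only: e cross_linear_combination) simp_all
    then show ?thesis using ab by simp
  qed
  ultimately show ?thesis by (meson interiorI)
qed

text \<open>Near the common side the coordinates along it stay positive. The transversal coordinates
  \<open>?b\<close> and \<open>?b'\<close> have the same numerator and denominators of opposite
  sign, so one of them is nonnegative and the point is in that triangle.\<close>

lemma triangles_interior_common_side:
  assumes D: "cross (p - u) (q - u) * cross (p - u) (q' - u) < 0" and a: "0 < a" "a < 1"
  shows "u + a *\<^sub>R (p - u) \<in> interior (convex hull {u, p, q} \<union> convex hull {u, p, q'})"
proof -
  let ?P = "p - u" and ?Q = "q - u" and ?Q' = "q' - u"
  let ?a = "\<lambda>x. cross (x - u) ?Q / cross ?P ?Q" and ?b = "\<lambda>x. cross ?P (x - u) / cross ?P ?Q"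
  let ?a' = "\<lambda>x. cross (x - u) ?Q' / cross ?P ?Q'" and ?b' = "\<lambda>x. cross ?P (x - u) / cross ?P ?Q'"
  let ?W = "{x. 0 < ?a x} \<inter> {x. 0 < ?a' x} \<inter> {x. ?a x + ?b x < 1} \<inter> {x. ?a' x + ?b' x < 1}"
  have D1: "cross ?P ?Q \<noteq> 0" "cross ?P ?Q' \<noteq> 0" using D by auto
  have "open ?W"
    by (intro open_Int open_Collect_less continuous_intros) (simp_all add: D1)
  moreover have "?W \<subseteq> convex hull {u, p, q} \<union> convex hull {u, p, q'}"
  proof
    fix x assume x: "x \<in> ?W"
    have 1: "x = u + ?a x *\<^sub>R (p - u) + ?b x *\<^sub>R (q - u)"
      using cross_cramer[OF D1(1), of "x - u"] by (simp add: add.assoc)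
    have 2: "x = u + ?a' x *\<^sub>R (p - u) + ?b' x *\<^sub>R (q' - u)"
      using cross_cramer[OF D1(2), of "x - u"] by (simp add: add.assoc)
    have "0 \<le> ?b x \<or> 0 \<le> ?b' x"
      using D by (auto simp: zero_le_divide_iff mult_less_0_iff)
    then show "x \<in> convex hull {u, p, q} \<union> convex hull {u, p, q'}"
    proof
      assume "0 \<le> ?b x"
      then have "x \<in> convex hull {u, p, q}" unfolding convex_hull_3_alt
        using x 1 by (intro CollectI exI[of _ "?a x"] exI[of _ "?b x"]) auto
      then show ?thesis by simp
    next
      assume "0 \<le> ?b' x"
      then have "x \<in> convex hull {u, p, q'}" unfolding convex_hull_3_alt
        using x 2 by (intro CollectI exI[of _ "?a' x"] exI[of _ "?b' x"]) auto
      then show ?thesis by simp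
    qed
  qed
  moreover have "u + a *\<^sub>R (p - u) \<in> ?W"
  proof -
    let ?x = "u + a *\<^sub>R ?P"
    have e: "?x - u = a *\<^sub>R ?P" by simp
    have w: "?a ?x = a" "?b ?x = 0" "?a' ?x = a" "?b' ?x = 0"
      unfolding e cross_simps(1,8,9) using D1
      by (simp_all only: nonzero_mult_div_cancel_right not_False_eq_True mult_zero_right div_0)
    then show ?thesis unfolding Int_iff mem_Collect_eq w using a by simp
  qed
  ultimately show ?thesis by (meson interiorI)
qed

lemma edge_length_doubleton: "edge_length {u, v} = dist u v"
proof (rule antisym)
  show "edge_length {u, v} \<le> dist u v"
    unfolding edge_length_def by (rule diameter_le) (auto simp: dist_norm norm_minus_commute)
  show "dist u v \<le> edge_length {u, v}"
    unfolding edge_length_def by (rule diameter_bounded_bound) auto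
qed

text \<open>Points off \<open>K\<close> belong to the unbounded part of the complement of the
  frontier, which the closure of a bounded set cannot enter.\<close>

lemma bounded_subset_of_frontier_subset:
  fixes S :: "'a :: euclidean_space set"
  assumes "bounded S" "frontier S \<subseteq> K" "convex K"
  shows "closure S \<subseteq> K"
proof -
  have "- K \<subseteq> outside (frontier S)" by (rule outside_subset_convex) (use assms in auto)
  also have "\<dots> \<subseteq> - closure S" by (rule outside_frontier_misses_closure[OF assms(1)])
  finally show ?thesis by auto
qed

section \<open>Faces of an isoradial graph\<close>

locale isoradial =
  fixes G :: plane_graph and h c\<^sub>p c\<^sub>d :: real
  assumes h_pos: "0 < h" and iso: "isoradial_graph h G"
    and cp_pos: "0 < c\<^sub>p" and cd_pos: "0 < c\<^sub>d"
    and edge_length_ge: "e \<in> edges G \<Longrightarrow> c\<^sub>p * h \<le> edge_length e"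
    and dual_edge_length_ge: "e \<in> dual_edges G \<Longrightarrow> c\<^sub>d * h \<le> edge_length e"
begin

abbreviation "adj u v \<equiv> {u, v} \<in> edges G"

definition side_of :: "complex set \<Rightarrow> complex \<Rightarrow> complex \<Rightarrow> bool" where
  "side_of f u v \<longleftrightarrow> adj u v \<and> closed_segment u v \<subseteq> frontier f"

lemma embedded:
  "e \<in> edges G \<Longrightarrow> \<exists>u\<in>verts G. \<exists>v\<in>verts G. u \<noteq> v \<and> e = {u, v}"
  "e \<in> edges G \<Longrightarrow> convex hull e \<inter> verts G = e"
  "e \<in> edges G \<Longrightarrow> e' \<in> edges G \<Longrightarrow> e \<noteq> e' \<Longrightarrow> convex hull e \<inter> convex hull e' = e \<inter> e'"
  using iso by (simp_all add: isoradial_graph_def embedded_graph_def)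

lemma adj_commute: "adj u v \<longleftrightarrow> adj v u"
  by (simp add: insert_commute)

lemma side_of_commute: "side_of f u v \<longleftrightarrow> side_of f v u"
  by (simp add: side_of_def insert_commute closed_segment_commute)

lemma adjD:
  assumes "adj u v" shows "u \<in> verts G" "v \<in> verts G" "u \<noteq> v"
proof -
  obtain a b where "a \<in> verts G" "b \<in> verts G" "a \<noteq> b" "{u, v} = {a, b}"
    using embedded(1)[OF assms] by blast
  then show "u \<in> verts G" "v \<in> verts G" "u \<noteq> v" by (auto simp: doubleton_eq_iff)
qed

lemma edgeE:
  assumes "e \<in> edges G" obtains u v where "adj u v" "e = {u, v}"
  using embedded(1)[OF assms] assms by blast

lemma vert_in_edge:
  assumes "adj u v" "w \<in> verts G" "w \<in> closed_segment u v"
  shows "w = u \<or> w = v"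
proof -
  have "convex hull {u, v} \<inter> verts G = {u, v}"
    using embedded(2) assms(1) by blast
  then show ?thesis using assms by (auto simp: segment_convex_hull)
qed

lemma edges_inter:
  assumes "adj u v" "adj u' v'" "p \<in> closed_segment u v" "p \<in> closed_segment u' v'"
    "{u, v} \<noteq> {u', v'}"
  shows "p \<in> {u, v} \<inter> {u', v'}"
proof -
  have "convex hull {u, v} \<inter> convex hull {u', v'} = {u, v} \<inter> {u', v'}"
    using embedded(3) assms(1,2,5) by blast
  then show ?thesis using assms(3,4) unfolding segment_convex_hull by blast
qed

lemma open_segment_edge_unique:
  assumes "adj u v" "adj u' v'" "p \<in> open_segment u v" "p \<in> closed_segment u' v'"
  shows "{u, v} = {u', v'}"
  using edges_inter[OF assms(1,2), of p] assms(3,4) by (auto simp: open_segment_def)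

lemma adj_segment_skeleton: "adj u v \<Longrightarrow> closed_segment u v \<subseteq> skeleton G"
  by (auto simp: skeleton_def segment_convex_hull)

lemma faceD:
  assumes "f \<in> faces G"
  shows "connected f" "f \<inter> skeleton G = {}" "f \<noteq> {}" "bounded f"
proof -
  have f: "f \<in> components (- skeleton G)" using assms by (simp add: faces_def)
  show "connected f" by (rule in_components_connected[OF f])
  show "f \<noteq> {}" by (rule in_components_nonempty[OF f])
  show "f \<inter> skeleton G = {}" using in_components_subset[OF f] by auto
  show "bounded f" using iso assms unfolding isoradial_graph_def by blast
qed

lemma faces_cover: "\<exists>f\<in>faces G. p \<in> closure f"
  using iso unfolding isoradial_graph_def by blast

lemma skeleton_frontier:
  assumes "f \<in> faces G" "p \<in> closure f" "p \<in> skeleton G" shows "p \<in> frontier f"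
  using faceD(2)[OF assms(1)] assms interior_subset[of f] by (auto simp: frontier_def)

lemma polygon:
  assumes "f \<in> faces G"
  obtains vs where "length vs \<ge> 3" "distinct vs"
    "\<And>i. i < length vs \<Longrightarrow> side_of f (vs ! i) (vs ! (Suc i mod length vs))"
    "frontier f = (\<Union>i<length vs. closed_segment (vs ! i) (vs ! (Suc i mod length vs)))"
proof -
  obtain vs where vs: "length vs \<ge> 3" "distinct vs"
    "\<And>i. i<length vs \<Longrightarrow> {vs ! i, vs ! (Suc i mod length vs)} \<in> edges G"
    "frontier f = (\<Union>i<length vs. closed_segment (vs ! i) (vs ! (Suc i mod length vs)))"
    using iso assms unfolding isoradial_graph_def polygonal_face_def by blast
  then show ?thesis by (intro that[of vs]) (auto simp: side_of_def)
qed

lemma frontier_side: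
  assumes "f \<in> faces G" "p \<in> frontier f"
  obtains u v where "side_of f u v" "p \<in> closed_segment u v"
proof -
  obtain vs where "length vs \<ge> 3" "distinct vs"
    "\<And>i. i < length vs \<Longrightarrow> side_of f (vs ! i) (vs ! (Suc i mod length vs))"
    "frontier f = (\<Union>i<length vs. closed_segment (vs ! i) (vs ! (Suc i mod length vs)))"
    using polygon[OF assms(1)] by blast
  then show ?thesis using that assms(2) by blast
qed

lemma side_ofI:
  assumes "f \<in> faces G" "adj u v" "p \<in> open_segment u v" "p \<in> closure f"
  shows "side_of f u v"
proof -
  have "p \<in> skeleton G" using adj_segment_skeleton[OF assms(2)] assms(3) by (auto simp: open_segment_def)
  then have "p \<in> frontier f" using skeleton_frontier assms by blast
  then obtain a b where ab: "side_of f a b" "p \<in> closed_segment a b"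
    using frontier_side assms(1) by blast
  then have "{u, v} = {a, b}" 
    using open_segment_edge_unique[OF assms(2), of a b p] assms(3) by (auto simp: side_of_def)
  then show ?thesis using ab by (auto simp: doubleton_eq_iff side_of_commute)
qed

lemma side_of_verts:
  assumes "side_of f u v" shows "u \<in> face_verts G f" "v \<in> face_verts G f"
  using assms adjD[of u v] ends_in_segment[of u v] by (auto simp: side_of_def face_verts_def)

text \<open>A vertex on a side is an end of it by the embedding condition, so the frontier carries
  no vertices other than the corners of the polygon.\<close>

lemma face_verts_eq_set:
  assumes "f \<in> faces G" and vs: "length vs \<ge> 3"
    "\<And>i. i < length vs \<Longrightarrow> side_of f (vs ! i) (vs ! (Suc i mod length vs))"
    "frontier f = (\<Union>i<length vs. closed_segment (vs ! i) (vs ! (Suc i mod length vs)))"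
  shows "face_verts G f = set vs"
proof
  have n: "Suc i mod length vs < length vs" for i using vs(1) by (intro mod_less_divisor) auto
  show "face_verts G f \<subseteq> set vs"
  proof
    fix w assume w: "w \<in> face_verts G f"
    then obtain i where i: "i < length vs" "w \<in> closed_segment (vs ! i) (vs ! (Suc i mod length vs))"
      using vs(3) by (auto simp: face_verts_def)
    then have "w = vs ! i \<or> w = vs ! (Suc i mod length vs)"
      using vs(2)[OF i(1)] w vert_in_edge by (auto simp: face_verts_def side_of_def)
    then show "w \<in> set vs" using nth_mem[OF i(1)] nth_mem[OF n[of i]] by auto
  qed
  show "set vs \<subseteq> face_verts G f"
    using side_of_verts(1)[OF vs(2)] by (auto simp: in_set_conv_nth)
qed

lemma center_ex: "f \<in> faces G \<Longrightarrow> \<exists>m\<in>f. face_verts G f \<subseteq> sphere m (h / 2)"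
  using iso unfolding isoradial_graph_def by blast

text \<open>Three distinct corners determine the centre, whatever the radius of the competing
  circle. Hence the definite description in \<open>circumcenter\<close> denotes the centre that
  isoradiality provides.\<close>

lemma center_eqI:
  assumes "f \<in> faces G" "face_verts G f \<subseteq> sphere m r"
  shows "circumcenter G f = m"
  unfolding circumcenter_def
proof (rule the_equality)
  show "\<exists>r. face_verts G f \<subseteq> sphere m r" using assms by blast
next
  fix m' assume "\<exists>r. face_verts G f \<subseteq> sphere m' r"
  then obtain r' where r': "face_verts G f \<subseteq> sphere m' r'" by blast
  obtain vs where vs: "length vs \<ge> 3" "distinct vs"
    "\<And>i. i < length vs \<Longrightarrow> side_of f (vs ! i) (vs ! (Suc i mod length vs))"
    "frontier f = (\<Union>i<length vs. closed_segment (vs ! i) (vs ! (Suc i mod length vs)))"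
    using polygon assms(1) by blast
  have e: "face_verts G f = set vs" by (rule face_verts_eq_set[OF assms(1) vs(1,3,4)])
  have i: "vs ! 0 \<in> set vs" "vs ! 1 \<in> set vs" "vs ! 2 \<in> set vs"
    using vs(1) by (intro nth_mem; linarith)+
  have n: "vs ! 0 \<noteq> vs ! 1" "vs ! 0 \<noteq> vs ! 2" "vs ! 1 \<noteq> vs ! 2"
    using vs(1,2) by (subst nth_eq_iff_index_eq; force)+
  show "m' = m" using i r' assms(2) unfolding e
    by (intro circle_center_unique[of m' "vs ! 0" r' "vs ! 1" "vs ! 2" m r] n) auto
qed

abbreviation "ctr f \<equiv> circumcenter G f"

lemma ctr:
  assumes "f \<in> faces G"
  shows "ctr f \<in> f" "face_verts G f \<subseteq> sphere (ctr f) (h / 2)"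
proof -
  obtain m where "m \<in> f" "face_verts G f \<subseteq> sphere m (h / 2)" using center_ex assms by blast
  with center_eqI[OF assms, of m] show "ctr f \<in> f" "face_verts G f \<subseteq> sphere (ctr f) (h / 2)" by auto
qed

lemma dist_ctr_side:
  assumes "f \<in> faces G" "side_of f u v"
  shows "dist (ctr f) u = h / 2" "dist (ctr f) v = h / 2"
  using ctr(2)[OF assms(1)] side_of_verts[OF assms(2)] by auto

text \<open>The sides are chords of the circumscribed disc, so the frontier lies in this convex set,
  and with it the bounded face.\<close>

lemma face_subset_cball:
  assumes "f \<in> faces G"
  shows "closure f \<subseteq> cball (ctr f) (h / 2)"
proof (rule bounded_subset_of_frontier_subset[OF faceD(4)[OF assms]])
  show "frontier f \<subseteq> cball (ctr f) (h / 2)"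
  proof
    fix p assume "p \<in> frontier f"
    then obtain u v where "side_of f u v" "p \<in> closed_segment u v" using frontier_side assms by blast
    with dist_ctr_side[OF assms this(1)] show "p \<in> cball (ctr f) (h / 2)"
      using closed_segment_subset[of u "cball (ctr f) (h/2)" v] by auto
  qed
qed auto

text \<open>A side is a chord of the circumscribed disc, so the line through it meets the disc only in the
  side. Hence the face, being connected, lies in one of the open half-planes of that line.\<close>

lemma face_line_disjoint:
  assumes "f \<in> faces G" "side_of f u v" "x \<in> f"
  shows "cross (v - u) (x - u) \<noteq> 0"
proof
  assume 0: "cross (v - u) (x - u) = 0"
  have "u \<noteq> v" using assms(2) adjD by (auto simp: side_of_def)
  moreover have "dist (ctr f) x \<le> h / 2"
    using face_subset_cball[OF assms(1)] assms(3) closure_subset[of f] mem_cball by blast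
  ultimately have "x \<in> closed_segment u v"
    using chord_line_in_disc dist_ctr_side[OF assms(1,2)] 0 by blast
  then have "x \<in> skeleton G" using adj_segment_skeleton assms(2) by (auto simp: side_of_def)
  then show False using faceD(2)[OF assms(1)] assms(3) by auto
qed

lemma face_one_side:
  assumes "f \<in> faces G" "side_of f u v" "x \<in> f" "y \<in> f"
  shows "cross (v - u) (x - u) * cross (v - u) (y - u) > 0"
proof -
  have "is_interval ((\<lambda>x. cross (v - u) (x - u)) ` f)"
    unfolding is_interval_connected_1
    by (intro connected_continuous_image continuous_intros faceD(1)[OF assms(1)])
  moreover have "0 \<notin> (\<lambda>x. cross (v - u) (x - u)) ` f"
    using face_line_disjoint[OF assms(1,2)] by force
  ultimately have "\<not> (cross (v - u) (x - u) \<le> 0 \<and> 0 \<le> cross (v - u) (y - u))"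
    "\<not> (cross (v - u) (y - u) \<le> 0 \<and> 0 \<le> cross (v - u) (x - u))"
    using assms(3,4) unfolding is_interval_1 by blast+
  then show ?thesis by (auto simp: zero_less_mult_iff)
qed

lemma closure_face_one_side:
  assumes "f \<in> faces G" "side_of f u v" "x \<in> closure f"
  shows "cross (v - u) (x - u) * cross (v - u) (ctr f - u) \<ge> 0"
proof -
  let ?S = "{x. cross (v - u) (x - u) * cross (v - u) (ctr f - u) \<ge> 0}"
  have "closed ?S" by (intro closed_Collect_le continuous_intros)
  moreover have "f \<subseteq> ?S"
    using face_one_side[OF assms(1,2) _ ctr(1)[OF assms(1)]] by (auto intro: less_imp_le)
  ultimately have "closure f \<subseteq> ?S" by (rule closure_minimal[rotated])
  then show ?thesis using assms(3) by auto
qed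

text \<open>The intersection \<open>?I\<close> of the open half-planes of the sides contains
  \<open>f\<close> and misses its frontier. Being connected, it cannot leave \<open>f\<close>, so
  the two sets coincide.\<close>

lemma convex_face:
  assumes "f \<in> faces G" shows "convex f"
proof -
  define H where "H = (\<lambda>u v. {x. cross (v - u) (x - u) * cross (v - u) (ctr f - u) > 0})"
  let ?I = "\<Inter>(u,v)\<in>{(u,v). side_of f u v}. H u v"
  have cH: "convex (H u v)" for u v
  proof (rule convexI)
    fix x y and a b :: real
    assume xy: "x \<in> H u v" "y \<in> H u v" and ab: "0 \<le> a" "0 \<le> b" "a + b = 1"
    let ?c = "cross (v - u) (ctr f - u)"
    have "a *\<^sub>R x + b *\<^sub>R y - u = a *\<^sub>R (x - u) + b *\<^sub>R (y - u)"
      using ab(3) by (simp add: algebra_simps flip: scaleR_add_left)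
    then have "cross (v - u) (a *\<^sub>R x + b *\<^sub>R y - u) * ?c
        = a * (cross (v - u) (x - u) * ?c) + b * (cross (v - u) (y - u) * ?c)"
      by (simp only: cross_simps) (simp add: algebra_simps)
    also have "\<dots> > 0"
    proof (cases "a = 0")
      case True then show ?thesis using xy(2) ab by (simp add: H_def)
    next
      case False
      then have "0 < a * (cross (v - u) (x - u) * ?c)" using xy(1) ab by (simp add: H_def)
      moreover have "0 \<le> b * (cross (v - u) (y - u) * ?c)" using xy(2) ab by (simp add: H_def)
      ultimately show ?thesis by linarith
    qed
    finally show "a *\<^sub>R x + b *\<^sub>R y \<in> H u v" by (simp add: H_def)
  qed
  have conv: "convex ?I" by (intro convex_INT) (auto intro: cH)
  have sub: "f \<subseteq> ?I"
    using face_one_side[OF assms _ _ ctr(1)[OF assms]] by (auto simp: H_def)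
  have "?I \<inter> frontier f = {}"
  proof (rule ccontr)
    assume "?I \<inter> frontier f \<noteq> {}"
    then obtain p where p: "p \<in> ?I" "p \<in> frontier f" by auto
    then obtain u v where uv: "side_of f u v" "p \<in> closed_segment u v" using frontier_side assms by blast
    then obtain s where "p = u + s *\<^sub>R (v - u)" by (auto simp: in_segment algebra_simps)
    then have "cross (v - u) (p - u) = 0" by (simp add: cross_simps)
    then have "p \<notin> H u v" by (simp add: H_def)
    then show False using p(1) uv(1) by auto
  qed
  then have "?I - f = {}"
    using connected_Int_frontier[OF convex_connected[OF conv], of f] sub ctr(1)[OF assms] by blast
  then have "f = ?I" using sub by auto
  then show ?thesis using conv by simp
qed

lemma vert_side:
  assumes "f \<in> faces G" "u \<in> verts G" "u \<in> closure f"
  obtains v where "side_of f u v"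
proof -
  have "u \<in> frontier f" using skeleton_frontier assms by (auto simp: skeleton_def)
  then obtain a b where ab: "side_of f a b" "u \<in> closed_segment a b" using frontier_side assms(1) by blast
  then have "u = a \<or> u = b" using vert_in_edge assms(2) by (auto simp: side_of_def)
  then show ?thesis using ab side_of_commute that by blast
qed

text \<open>The closed faces cover the plane, so one of them contains the midpoint of the edge; a
  closed face that meets the relative interior of an edge has the whole edge as a side.\<close>

lemma adj_side:
  assumes "adj u v" obtains f where "f \<in> faces G" "side_of f u v"
proof -
  have "midpoint u v \<in> open_segment u v" using adjD[OF assms] by simp
  then show ?thesis using faces_cover side_ofI[OF _ assms] that by blast
qed

lemma edge_length_le: assumes "adj u v" shows "dist u v \<le> h"
proof -
  obtain f where f: "f \<in> faces G" "side_of f u v" using adj_side assms by blast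
  show ?thesis using dist_ctr_side[OF f] dist_triangle[of u v "ctr f"] by (simp add: dist_commute)
qed

lemma edge_length_ge': "adj u v \<Longrightarrow> c\<^sub>p * h \<le> dist u v"
  using edge_length_ge edge_length_doubleton by metis

section \<open>Local structure of the skeleton\<close>

lemma finite_verts_Int: "bounded B \<Longrightarrow> finite (verts G \<inter> B)"
  using iso unfolding isoradial_graph_def locally_finite_graph_def by blast

text \<open>Edges have length at most \<open>h\<close>, so an edge that meets
  \<open>cball 0 R\<close> has both ends in \<open>cball 0 (R + h)\<close>, where there are finitely
  many vertices.\<close>

lemma finite_edges_meeting:
  assumes "bounded B" shows "finite {e \<in> edges G. convex hull e \<inter> B \<noteq> {}}"
proof -
  obtain R where "\<forall>x\<in>B. norm x \<le> R" using assms bounded_iff by blast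
  then have R: "B \<subseteq> cball 0 R" by auto
  have "{e \<in> edges G. convex hull e \<inter> B \<noteq> {}} \<subseteq> Pow (verts G \<inter> cball 0 (R + h))"
  proof
    fix e assume "e \<in> {e \<in> edges G. convex hull e \<inter> B \<noteq> {}}"
    then obtain p where e: "e \<in> edges G" "p \<in> convex hull e" "p \<in> B" by blast
    obtain u v where uv: "adj u v" "e = {u, v}" using edgeE e(1) by blast
    have "w \<in> cball 0 (R + h)" if w: "w \<in> e" for w
    proof -
      have "dist p w \<le> dist u v"
        using uv e w dist_in_closed_segment[of p u v] by (auto simp: segment_convex_hull)
      then have "dist p w \<le> h" using edge_length_le[OF uv(1)] by simp
      moreover have "dist 0 p \<le> R" using R e by auto
      ultimately show ?thesis using dist_triangle[of 0 w p] by (simp add: dist_commute)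
    qed
    then show "e \<in> Pow (verts G \<inter> cball 0 (R + h))" using uv adjD by blast
  qed
  then show ?thesis using finite_verts_Int[of "cball 0 (R+h)"] finite_subset by blast
qed

text \<open>There are no isolated vertices: a vertex lies in the closure of some face, hence on its
  frontier, hence at the end of a side.\<close>

lemma skeleton_eq: "skeleton G = (\<Union>e\<in>edges G. convex hull e)"
proof -
  have "u \<in> (\<Union>e\<in>edges G. convex hull e)" if u: "u \<in> verts G" for u
  proof -
    obtain f where "f \<in> faces G" "u \<in> closure f" using faces_cover by blast
    then obtain v where "side_of f u v" using vert_side u by blast
    then show ?thesis by (auto simp: side_of_def hull_inc intro!: bexI[of _ "{u, v}"])
  qed
  then show ?thesis by (auto simp: skeleton_def)
qed

text \<open>Only finitely many edges come near \<open>p\<close>, so those among them that avoid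
  \<open>p\<close> form a closed set with a positive distance from \<open>p\<close>.\<close>

lemma skeleton_local:
  obtains r where "r > 0" "\<And>e. e \<in> edges G \<Longrightarrow> convex hull e \<inter> ball p r \<noteq> {} \<Longrightarrow> p \<in> convex hull e"
proof -
  let ?E = "{e \<in> edges G. convex hull e \<inter> ball p 1 \<noteq> {} \<and> p \<notin> convex hull e}"
  have fin: "finite ?E" by (rule finite_subset[OF _ finite_edges_meeting[of "ball p 1"]]) auto
  have "closed (\<Union>e\<in>?E. convex hull e)"
  proof (intro closed_UN fin ballI)
    fix e assume "e \<in> ?E"
    then obtain u v where "e = {u, v}" using edgeE by blast
    then show "closed (convex hull e)" by (simp flip: segment_convex_hull)
  qed
  then have "open (- (\<Union>e\<in>?E. convex hull e))" by (rule open_Compl)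
  moreover have "p \<in> - (\<Union>e\<in>?E. convex hull e)" by auto
  ultimately obtain r where r: "r > 0" "ball p r \<subseteq> - (\<Union>e\<in>?E. convex hull e)"
    by (rule openE)
  show ?thesis
  \<comment> \<open>The finite family was taken from the edges meeting the unit ball, so the radius
    must not exceed 1.\<close>
  proof (rule that[of "min r 1"])
    show "min r 1 > 0" using r by simp
    fix e assume e: "e \<in> edges G" "convex hull e \<inter> ball p (min r 1) \<noteq> {}"
    then obtain q where "q \<in> convex hull e" "q \<in> ball p r" "q \<in> ball p 1" by auto
    then show "p \<in> convex hull e" using e r by blast
  qed
qed

lemma closed_skeleton: "closed (skeleton G)"
proof -
  have "open (- skeleton G)"
    unfolding open_contains_ball
  proof
    fix p assume p: "p \<in> - skeleton G"
    obtain r where "r > 0" "\<And>e. e \<in> edges G \<Longrightarrow> convex hull e \<inter> ball p r \<noteq> {} \<Longrightarrow> p \<in> convex hull e"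
      using skeleton_local[of p] by blast
    then show "\<exists>r>0. ball p r \<subseteq> - skeleton G"
      using p unfolding skeleton_eq by (intro exI[of _ r]) blast
  qed
  then show ?thesis by (simp add: open_closed)
qed

lemma open_face: "f \<in> faces G \<Longrightarrow> open f"
  unfolding faces_def using open_components[of "- skeleton G"] closed_skeleton by blast

lemma connected_subset_face:
  assumes "connected S" "S \<noteq> {}" "S \<inter> skeleton G = {}"
  obtains f where "f \<in> faces G" "S \<subseteq> f"
proof -
  obtain x where x: "x \<in> S" using assms by blast
  have "connected_component_set (- skeleton G) x \<in> faces G"
    using x assms unfolding faces_def components_def by auto
  moreover have "S \<subseteq> connected_component_set (- skeleton G) x"
    using x assms by (intro connected_component_maximal) auto
  ultimately show ?thesis using that by blast
qed

lemma face_unique: "f \<in> faces G \<Longrightarrow> g \<in> faces G \<Longrightarrow> x \<in> f \<Longrightarrow> x \<in> g \<Longrightarrow> f = g"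
  unfolding faces_def using components_nonoverlap[of f "- skeleton G" g] by blast

text \<open>The edge \<open>{u, v}\<close> is the only one through its inner point \<open>p\<close>,
  so the open half-disc on the side chosen by \<open>\<sigma>\<close> avoids the skeleton. Being
  connected, it lies in a single face.\<close>

lemma halfdisc_face:
  assumes "adj u v" "p \<in> open_segment u v" "r > 0" "\<sigma> = 1 \<or> \<sigma> = -1"
    "\<And>e. e \<in> edges G \<Longrightarrow> convex hull e \<inter> ball p r \<noteq> {} \<Longrightarrow> p \<in> convex hull e"
  obtains f where "f \<in> faces G" "side_of f u v"
    "{x \<in> ball p r. \<sigma> * cross (v - u) (x - u) > 0} \<subseteq> f"
    "\<sigma> * cross (v - u) (ctr f - u) > 0"
proof -
  let ?S = "{x \<in> ball p r. \<sigma> * cross (v - u) (x - u) > 0}"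
  have uv: "u \<noteq> v" using adjD[OF assms(1)] by simp
  have oncross: "cross (v - u) (q - u) = 0" if "q \<in> closed_segment u v" for q
  proof -
    obtain s where "q = u + s *\<^sub>R (v - u)" using \<open>q \<in> closed_segment u v\<close> by (auto simp: in_segment algebra_simps)
    then show ?thesis by (simp add: cross_simps)
  qed
  have p: "p \<in> closed_segment u v" using assms(2) by (simp add: open_segment_def)
  have "?S = ball p r \<inter> {x. \<sigma> * cross (v - u) (x - u) > 0}" by auto
  moreover have "convex {x. \<sigma> * cross (v - u) (x - u) > 0}"
  proof (rule convexI)
    fix x y and a b :: real
    assume xy: "x \<in> {x. \<sigma> * cross (v - u) (x - u) > 0}" "y \<in> {x. \<sigma> * cross (v - u) (x - u) > 0}"
      and ab: "0 \<le> a" "0 \<le> b" "a + b = 1"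
    have "a *\<^sub>R x + b *\<^sub>R y - u = a *\<^sub>R (x - u) + b *\<^sub>R (y - u)"
      using ab(3) by (simp add: algebra_simps flip: scaleR_add_left)
    then have "\<sigma> * cross (v - u) (a *\<^sub>R x + b *\<^sub>R y - u)
        = a * (\<sigma> * cross (v - u) (x - u)) + b * (\<sigma> * cross (v - u) (y - u))"
      by (simp only: cross_simps) (simp add: algebra_simps)
    also have "\<dots> > 0"
      using xy ab by (cases "a = 0") (auto intro: add_pos_nonneg)
    finally show "a *\<^sub>R x + b *\<^sub>R y \<in> {x. \<sigma> * cross (v - u) (x - u) > 0}" by simp
  qed
  ultimately have "connected ?S" by (simp add: convex_Int convex_connected)
  have near: "p \<in> closure ?S"
  proof -
    \<comment> \<open>A normal of the edge on the side chosen by \<open>\<sigma>\<close>;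
      multiplication by the imaginary unit is a quarter turn. Moving from \<open>p\<close> along it
      gives points of the half-disc arbitrarily close to \<open>p\<close>.\<close>
    define n where "n = \<sigma> *\<^sub>R (\<i> * (v - u))"
    have n: "\<sigma> * cross (v - u) n > 0" and n0: "n \<noteq> 0"
    proof -
      have "cross (v - u) (\<i> * (v - u)) = (cmod (v - u))\<^sup>2"
        unfolding cmod_power2 by (simp add: cross_def power2_eq_square algebra_simps)
      then have "cross (v - u) (\<i> * (v - u)) > 0" using uv by simp
      then show "\<sigma> * cross (v - u) n > 0" using assms(4) by (auto simp: n_def cross_simps)
      then show "n \<noteq> 0" by (auto simp: cross_simps)
    qed
    show ?thesis unfolding closure_approachable
    proof (intro allI impI)
      fix e :: real assume e: "e > 0"
      define d where "d = min e r / (2 * cmod n)"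
      have d: "d > 0" using e assms(3) n0 by (simp add: d_def)
      have "dist (p + d *\<^sub>R n) p = min e r / 2" using n0 e assms(3) by (simp add: d_def dist_norm)
      then have 1: "dist (p + d *\<^sub>R n) p < e" "p + d *\<^sub>R n \<in> ball p r"
        using e assms(3) by (auto simp: dist_commute)
      have "p + d *\<^sub>R n - u = (p - u) + d *\<^sub>R n" by simp
      then have "cross (v - u) (p + d *\<^sub>R n - u) = d * cross (v - u) n"
        using oncross[OF p] by (simp only: cross_simps)
      then have "\<sigma> * cross (v - u) (p + d *\<^sub>R n - u) > 0"
        using mult_pos_pos[OF d n] by (simp add: mult.left_commute)
      then show "\<exists>y\<in>?S. dist y p < e" using 1 by blast
    qed
  qed
  have "?S \<inter> skeleton G = {}"
  proof (rule ccontr)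
    assume "?S \<inter> skeleton G \<noteq> {}"
    then obtain q e where q: "q \<in> ?S" "e \<in> edges G" "q \<in> convex hull e" unfolding skeleton_eq by blast
    then have pe: "p \<in> convex hull e" using assms(5)[of e] by blast
    obtain a b where ab: "adj a b" "e = {a, b}" using edgeE q(2) by blast
    have "{u, v} = {a, b}"
      using open_segment_edge_unique[OF assms(1) ab(1) assms(2)] pe ab by (simp add: segment_convex_hull)
    then have "q \<in> closed_segment u v" using q ab by (simp add: segment_convex_hull)
    then show False using oncross q(1) by simp
  qed
  moreover have "?S \<noteq> {}" 
  proof
    assume "?S = {}"
    then show False using near unfolding \<open>?S = {}\<close> by simp
  qed
  ultimately obtain f where f: "f \<in> faces G" "?S \<subseteq> f" 
    using connected_subset_face[of ?S] \<open>connected ?S\<close> by blast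
  then have "p \<in> closure f" using near closure_mono by blast
  then have side: "side_of f u v" using side_ofI[OF f(1) assms(1,2)] by blast
  obtain x where "x \<in> ?S" using \<open>?S \<noteq> {}\<close> by blast
  then have "\<sigma> * cross (v - u) (x - u) > 0" "x \<in> f" using f(2) by auto
  then have "\<sigma> * cross (v - u) (ctr f - u) > 0"
    using face_one_side[OF f(1) side _ ctr(1)[OF f(1)], of x] assms(4) by (auto simp: zero_less_mult_iff)
  then show ?thesis using that f side by blast
qed

text \<open>The two halves of a small disc centred on the edge lie in different faces because a face
  does not cross the lines through its sides.\<close>

lemma edge_faces:
  assumes "adj u v"
  obtains f g where "f \<in> faces G" "g \<in> faces G" "side_of f u v" "side_of g u v" "f \<noteq> g"
    "{k \<in> faces G. side_of k u v} = {f, g}"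
    "cross (v - u) (ctr f - u) > 0" "cross (v - u) (ctr g - u) < 0"
proof -
  define p where "p = midpoint u v"
  have p: "p \<in> open_segment u v" using adjD[OF assms] by (simp add: p_def)
  obtain r where r: "r > 0" "\<And>e. e \<in> edges G \<Longrightarrow> convex hull e \<inter> ball p r \<noteq> {} \<Longrightarrow> p \<in> convex hull e"
    using skeleton_local[of p] by blast
  obtain f where f: "f \<in> faces G" "side_of f u v" "{x \<in> ball p r. 1 * cross (v - u) (x - u) > 0} \<subseteq> f"
    "1 * cross (v - u) (ctr f - u) > 0"
    by (rule halfdisc_face[OF assms p r(1) _ r(2), of 1]) auto
  obtain g where g: "g \<in> faces G" "side_of g u v" "{x \<in> ball p r. -1 * cross (v - u) (x - u) > 0} \<subseteq> g"
    "-1 * cross (v - u) (ctr g - u) > 0"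
    by (rule halfdisc_face[OF assms p r(1) _ r(2), of "-1"]) auto
  \<comment> \<open>A face with this side accumulates at \<open>p\<close> and avoids the line, so it
    meets one of the half-discs. This excludes a third face.\<close>
  have meets: "\<exists>x\<in>k. x \<in> ball p r \<and> cross (v - u) (x - u) \<noteq> 0" if k: "k \<in> faces G" "side_of k u v" for k
  proof -
    have "p \<in> closure k" using k p by (auto simp: side_of_def open_segment_def frontier_def)
    then obtain x where "x \<in> k" "dist x p < r" using r(1) closure_approachable by blast
    then show ?thesis using face_line_disjoint[OF k] by (auto simp: dist_commute)
  qed
  have "k = f \<or> k = g" if k: "k \<in> faces G" "side_of k u v" for k
  proof -
    obtain x where x: "x \<in> k" "x \<in> ball p r" "cross (v - u) (x - u) \<noteq> 0" using meets[OF k] by blast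
    then have "x \<in> f \<or> x \<in> g" using f(3) g(3) by (cases "cross (v - u) (x - u) > 0") (auto simp: subset_iff)
    then show ?thesis using face_unique k f g x by blast
  qed
  then have "{k \<in> faces G. side_of k u v} = {f, g}" using f g by blast
  moreover have "f \<noteq> g" using f(4) g(4) by auto
  ultimately show ?thesis using that[of f g] f g by simp
qed

end

section \<open>Dual faces, separation of the vertices and graph distance\<close>

text \<open>Walks written as functions on the naturals, of which only the indices up to
  \<open>n\<close> matter, can be compared directly with the jump chain.\<close>

lemma graph_dist_walks:
  "graph_dist G u v = (LEAST n. \<exists>w::nat \<Rightarrow> complex. w 0 = u \<and> w n = v \<and> (\<forall>i<n. {w i, w (Suc i)} \<in> edges G))"
proof -
  have "(\<exists>vs. length vs = Suc n \<and> hd vs = u \<and> last vs = v \<and> successively (\<lambda>a b. {a, b} \<in> edges G) vs)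
    \<longleftrightarrow> (\<exists>w::nat \<Rightarrow> complex. w 0 = u \<and> w n = v \<and> (\<forall>i<n. {w i, w (Suc i)} \<in> edges G))" (is "?L \<longleftrightarrow> ?R") for n
  proof
    assume ?L
    then obtain vs where vs: "length vs = Suc n" "hd vs = u" "last vs = v"
      "successively (\<lambda>a b. {a, b} \<in> edges G) vs" by blast
    have ne: "vs \<noteq> []" using vs(1) by auto
    have "vs ! 0 = u" "vs ! n = v" using vs ne by (auto simp: hd_conv_nth last_conv_nth)
    moreover have "\<forall>i<n. {vs ! i, vs ! Suc i} \<in> edges G"
      using vs(1,4) by (auto simp: successively_conv_nth)
    ultimately show ?R by (intro exI[of _ "(!) vs"]) simp
  next
    assume ?R
    then obtain w where w: "w 0 = u" "w n = v" "\<forall>i<n. {w i, w (Suc i)} \<in> edges G" by blast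
    let ?vs = "map w [0..<Suc n]"
    have "successively (\<lambda>a b. {a, b} \<in> edges G) ?vs"
      using w(3) by (auto simp: successively_conv_nth simp del: upt_Suc)
    moreover have "?vs ! 0 = u" "?vs ! n = v" using w(1,2) by (simp_all del: upt_Suc)
    then have "hd ?vs = u" "last ?vs = v" 
      by (simp_all add: hd_conv_nth last_conv_nth del: upt_Suc)
    ultimately show ?L by (intro exI[of _ ?vs]) simp
  qed
  then show ?thesis unfolding graph_dist_def by simp
qed

lemma graph_dist_le:
  assumes "w 0 = u" "w n = v" "\<And>i. i < n \<Longrightarrow> {w i, w (Suc i)} \<in> edges G"
  shows "graph_dist G u v \<le> n"
  unfolding graph_dist_walks using assms by (intro Least_le) auto

lemma graph_dist_attained:
  assumes "w 0 = u" "w n = v" "\<And>i. i < n \<Longrightarrow> {w i, w (Suc i)} \<in> edges G"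
  obtains w' where "w' 0 = u" "w' (graph_dist G u v) = v"
    "\<And>i. i < graph_dist G u v \<Longrightarrow> {w' i, w' (Suc i)} \<in> edges G"
proof -
  have "\<exists>w::nat \<Rightarrow> complex. w 0 = u \<and> w (graph_dist G u v) = v
      \<and> (\<forall>i<graph_dist G u v. {w i, w (Suc i)} \<in> edges G)"
    unfolding graph_dist_walks
    by (rule LeastI_ex) (use assms in \<open>intro exI[of _ n] exI[of _ w], simp\<close>)
  then show ?thesis using that by blast
qed

lemma content_ball_complex: "r \<ge> 0 \<Longrightarrow> measure lborel (ball (p::complex) r) = pi * r\<^sup>2"
  using content_ball[of r p] by (simp add: unit_ball_vol_numeral)

context isoradial
begin

section \<open>Dual edges, edge weights and the two sides at a corner\<close>

text \<open>Both centres are at distance \<open>h / 2\<close> from \<open>u\<close> and from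
  \<open>v\<close> and lie on opposite sides of the edge, so the four points form a rhombus. The
  given \<open>f\<close> may be either of the two faces.\<close>

lemma dual_edge_eq:
  assumes "f \<in> faces G" "side_of f u v"
  obtains g where "g \<in> faces G" "side_of g u v" "ctr g = u + v - ctr f"
    "dual_edge G {u, v} = {ctr f, ctr g}" "adjacent_faces G f g"
proof -
  have adj: "adj u v" using assms(2) by (simp add: side_of_def)
  obtain f' g' where fg: "f' \<in> faces G" "g' \<in> faces G" "side_of f' u v" "side_of g' u v" "f' \<noteq> g'"
    "{k \<in> faces G. side_of k u v} = {f', g'}"
    "cross (v - u) (ctr f' - u) > 0" "cross (v - u) (ctr g' - u) < 0"
    using edge_faces[OF adj] by blast
  have de: "dual_edge G {u, v} = {ctr f', ctr g'}"
  proof -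
    have "{k \<in> faces G. convex hull {u, v} \<subseteq> frontier k} = {k \<in> faces G. side_of k u v}"
      using adj by (auto simp: side_of_def segment_convex_hull)
    then show ?thesis using fg(6) by (simp add: dual_edge_def)
  qed
  have adjf: "adjacent_faces G f' g'" "adjacent_faces G g' f'"
    using fg adj unfolding adjacent_faces_def side_of_def segment_convex_hull by blast+
  have rh: "ctr g' = u + v - ctr f'"
    using fg(7,8) dist_ctr_side[OF fg(1,3)] dist_ctr_side[OF fg(2,4)]
    by (intro rhombus[of _ _ "h / 2"]) (auto simp: mult_less_0_iff)
  have "f = f' \<or> f = g'" using fg(6) assms by blast
  then show ?thesis
  proof
    assume "f = f'" then show ?thesis using that[of g'] fg rh de adjf by blast
  next
    assume "f = g'" then show ?thesis using that[of f'] fg rh de adjf by (simp add: insert_commute)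
  qed
qed

text \<open>The edge has length between \<open>c\<^sub>p * h\<close> and \<open>h\<close>, its dual
  edge between \<open>c\<^sub>d * h\<close> and \<open>h\<close>, the last bound by the triangle
  inequality through \<open>u\<close>. In the quotient \<open>h\<close> cancels.\<close>

lemma edge_weight_bounds:
  assumes "adj u v" shows "c\<^sub>d \<le> edge_weight G u v" "edge_weight G u v \<le> 1 / c\<^sub>p"
proof -
  obtain f where f: "f \<in> faces G" "side_of f u v" using adj_side assms by blast
  obtain g where g: "g \<in> faces G" "side_of g u v" "dual_edge G {u, v} = {ctr f, ctr g}" "adjacent_faces G f g"
    by (rule dual_edge_eq[OF f]) (rule that)
  have "{ctr f, ctr g} \<in> dual_edges G" using f g by (auto simp: dual_edges_def)
  then have lo: "c\<^sub>d * h \<le> dist (ctr f) (ctr g)"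
    using dual_edge_length_ge by (metis edge_length_doubleton)
  have hi: "dist (ctr f) (ctr g) \<le> h"
    using dist_triangle[of "ctr f" "ctr g" u] dist_ctr_side[OF f] dist_ctr_side[OF g(1,2)] 
    by (simp add: dist_commute)
  have w: "edge_weight G u v = dist (ctr f) (ctr g) / dist u v"
    by (simp add: edge_weight_def g(3) edge_length_doubleton)
  have uv: "0 < dist u v" "dist u v \<le> h" "c\<^sub>p * h \<le> dist u v"
    using adjD[OF assms] edge_length_le[OF assms] edge_length_ge'[OF assms] by auto
  have "c\<^sub>d * dist u v \<le> c\<^sub>d * h" using uv cd_pos by simp
  then show "c\<^sub>d \<le> edge_weight G u v" using lo uv w by (simp add: pos_le_divide_eq)
  have "c\<^sub>p * dist (ctr f) (ctr g) \<le> c\<^sub>p * h" using hi cp_pos by simp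
  also have "\<dots> \<le> dist u v" by (rule uv)
  finally show "edge_weight G u v \<le> 1 / c\<^sub>p" using uv(1) w cp_pos by (simp add: divide_le_eq le_divide_eq mult.commute)
qed

lemma second_side:
  assumes "f \<in> faces G" "side_of f u v"
  obtains v' where "v' \<noteq> v" "side_of f u v'"
proof -
  obtain vs where vs: "length vs \<ge> 3" "distinct vs"
    "\<And>i. i < length vs \<Longrightarrow> side_of f (vs ! i) (vs ! (Suc i mod length vs))"
    "frontier f = (\<Union>i<length vs. closed_segment (vs ! i) (vs ! (Suc i mod length vs)))"
    using polygon assms(1) by blast
  let ?n = "length vs"
  have "u \<in> set vs" 
    using side_of_verts(1)[OF assms(2)] face_verts_eq_set[OF assms(1) vs(1,3,4)] by simp
  then obtain i where i: "i < ?n" "vs ! i = u" by (auto simp: in_set_conv_nth)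
  \<comment> \<open>Cyclic successor and predecessor of the corner \<open>u\<close>. They differ
    because the polygon has at least three corners.\<close>
  define a where "a = Suc i mod ?n"
  define b where "b = (if i = 0 then ?n - 1 else i - 1)"
  have b: "b < ?n" "Suc b mod ?n = i" using i vs(1) by (auto simp: b_def)
  have a: "a < ?n" unfolding a_def using vs(1) by (intro mod_less_divisor) auto
  have "a \<noteq> b"
  proof (cases "Suc i = ?n")
    case True then show ?thesis using vs(1) by (auto simp: a_def b_def)
  next
    case False
    then have "a = Suc i" using i by (simp add: a_def)
    then show ?thesis using False vs(1) i by (auto simp: b_def)
  qed
  then have "vs ! a \<noteq> vs ! b" using a b vs(2) by (simp add: nth_eq_iff_index_eq)
  moreover have "side_of f u (vs ! a)" using vs(3)[OF i(1)] i by (simp add: a_def)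
  moreover have "side_of f u (vs ! b)" using vs(3)[OF b(1)] b i side_of_commute by simp
  ultimately show ?thesis using that by metis
qed

text \<open>The closed face lies in a half-plane of each side. So the centre is on the
  \<open>v'\<close> side of the line through \<open>u\<close> and \<open>v\<close> and on the
  \<open>v\<close> side of the line through \<open>u\<close> and \<open>v'\<close>, that is, inside
  the angle at \<open>u\<close>.\<close>

lemma center_between_sides:
  assumes "f \<in> faces G" "side_of f u v" "side_of f u v'" "v \<noteq> v'"
  shows "cross (ctr f - u) (v - u) * cross (ctr f - u) (v' - u) < 0"
proof -
  let ?k = "cross (v - u) (v' - u)"
  have uv: "u \<noteq> v" "u \<noteq> v'" using assms adjD by (auto simp: side_of_def)
  have "v \<in> closure f" "v' \<in> closure f"
    using assms ends_in_segment by (auto simp: side_of_def frontier_def)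
  then have 1: "?k * cross (v - u) (ctr f - u) \<ge> 0" "cross (v' - u) (v - u) * cross (v' - u) (ctr f - u) \<ge> 0"
    using closure_face_one_side assms by blast+
  have 2: "?k \<noteq> 0" using circle_not_collinear[of "ctr f" u "h/2" v v'] uv assms(4)
      dist_ctr_side[OF assms(1,2)] dist_ctr_side[OF assms(1,3)] by simp
  have 3: "cross (v - u) (ctr f - u) \<noteq> 0" "cross (v' - u) (ctr f - u) \<noteq> 0"
    using face_line_disjoint[OF assms(1)] assms ctr(1) by blast+
  have c: "cross (v' - u) (v - u) = - ?k" "cross (ctr f - u) (v - u) = - cross (v - u) (ctr f - u)"
    "cross (ctr f - u) (v' - u) = - cross (v' - u) (ctr f - u)" by (rule cross_commute)+
  have "?k * cross (v' - u) (ctr f - u) \<le> 0" using 1(2) unfolding c by simp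
  then show ?thesis using 1(1) 2 3 unfolding c(2,3)
    by (auto simp: zero_le_mult_iff mult_le_0_iff mult_less_0_iff)
qed

section \<open>The star of a vertex and its dual face\<close>

text \<open>A closed set meant to contain the dual face: the triangles with apex \<open>u\<close>
  over the dual edges. As a plain union over the neighbours it needs no order among them.\<close>

definition star :: "complex \<Rightarrow> complex set" where
  "star u = (\<Union>v\<in>{v. adj u v}. convex hull (insert u (dual_edge G {u, v})))"

definition dual_boundary :: "complex \<Rightarrow> complex set" where
  "dual_boundary u = (\<Union>v\<in>{v. adj u v}. convex hull (dual_edge G {u, v}))"

lemma dual_face_eq: "dual_face G u = connected_component_set (- dual_boundary u) u"
proof -
  have "{e \<in> edges G. u \<in> e} = (\<lambda>v. {u, v}) ` {v. adj u v}"
  proof -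
    have "e \<in> (\<lambda>v. {u, v}) ` {v. adj u v}" if e: "e \<in> edges G" "u \<in> e" for e
    proof -
      obtain a b where ab: "adj a b" "e = {a, b}" using edgeE e(1) by blast
      then show ?thesis using e adj_commute by auto
    qed
    then show ?thesis by auto
  qed
  then show ?thesis by (simp add: dual_face_def dual_boundary_def)
qed

lemma finite_neighbours: "finite {v. adj u v}"
proof (rule finite_subset)
  show "{v. adj u v} \<subseteq> verts G \<inter> cball u h" using adjD edge_length_le by auto
qed (simp add: finite_verts_Int)

text \<open>The neighbouring centre is the reflection of \<open>ctr f\<close> in the midpoint of the
  edge, so it lies on the same side as \<open>v\<close> of the line through \<open>u\<close> and
  \<open>ctr f\<close>.\<close>

lemma cross_neighbour_centers:
  assumes "ctr g = u + v - ctr f"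
  shows "cross (ctr f - u) (ctr g - u) = cross (ctr f - u) (v - u)"
proof -
  have "ctr g - u = (v - u) - (ctr f - u)" using assms by simp
  then show ?thesis by (simp only: cross_simps)
qed

text \<open>The dual edges of two sides of \<open>f\<close> at \<open>u\<close> meet in
  \<open>ctr f\<close>. Since the centre lies between the sides, the other two centres lie on
  opposite sides of the ray from \<open>u\<close>, and the two triangles together surround each
  inner point of their common segment.\<close>

lemma star_ray_interior:
  assumes "f \<in> faces G" "side_of f u v" "0 < a" "a < 1"
  shows "u + a *\<^sub>R (ctr f - u) \<in> interior (star u)"
proof -
  obtain v' where v': "v' \<noteq> v" "side_of f u v'" using second_side assms by blast
  obtain g where g: "ctr g = u + v - ctr f" "dual_edge G {u, v} = {ctr f, ctr g}"
    by (rule dual_edge_eq[OF assms(1,2)]) (rule that)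
  obtain g' where g': "ctr g' = u + v' - ctr f" "dual_edge G {u, v'} = {ctr f, ctr g'}"
    by (rule dual_edge_eq[OF assms(1) v'(2)]) (rule that)
  have "cross (ctr f - u) (ctr g - u) * cross (ctr f - u) (ctr g' - u) < 0"
    unfolding cross_neighbour_centers[OF g(1)] cross_neighbour_centers[OF g'(1)]
    using center_between_sides assms v' by simp
  then have "u + a *\<^sub>R (ctr f - u) \<in> interior (convex hull {u, ctr f, ctr g} \<union> convex hull {u, ctr f, ctr g'})"
    using assms by (intro triangles_interior_common_side)
  moreover have "convex hull {u, ctr f, ctr g} \<union> convex hull {u, ctr f, ctr g'} \<subseteq> star u"
    unfolding star_def using assms(2) v'(2) g(2) g'(2) by (force simp: side_of_def)
  ultimately show ?thesis using interior_mono by blast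
qed

lemma starE:
  assumes "p \<in> star u"
  obtains v f g a b where "f \<in> faces G" "g \<in> faces G" "side_of f u v" "side_of g u v"
    "ctr g = u + v - ctr f" "dual_edge G {u, v} = {ctr f, ctr g}"
    "p = u + a *\<^sub>R (ctr f - u) + b *\<^sub>R (ctr g - u)" "0 \<le> a" "0 \<le> b" "a + b \<le> 1"
proof -
  obtain v where v: "adj u v" "p \<in> convex hull (insert u (dual_edge G {u, v}))"
    using assms by (auto simp: star_def)
  obtain f where f: "f \<in> faces G" "side_of f u v" using adj_side v(1) by blast
  obtain g where g: "g \<in> faces G" "side_of g u v" "ctr g = u + v - ctr f" "dual_edge G {u, v} = {ctr f, ctr g}"
    by (rule dual_edge_eq[OF f]) (rule that)
  have "p \<in> convex hull {u, ctr f, ctr g}" using v(2) g(4) by simp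
  then show ?thesis unfolding convex_hull_3_alt using that f g by blast
qed

text \<open>In the coordinates \<open>a\<close> and \<open>b\<close> of a triangle the dual edge is
  \<open>a + b = 1\<close>. Besides \<open>u\<close> this leaves the open triangle and the two open
  segments from \<open>u\<close> to the centres, across which the star continues.\<close>

lemma star_interior:
  assumes "p \<in> star u" "p \<noteq> u" "p \<notin> dual_boundary u"
  shows "p \<in> interior (star u)"
proof -
  obtain v f g a b where fg: "f \<in> faces G" "g \<in> faces G" "side_of f u v" "side_of g u v"
    "ctr g = u + v - ctr f" "dual_edge G {u, v} = {ctr f, ctr g}"
    and p: "p = u + a *\<^sub>R (ctr f - u) + b *\<^sub>R (ctr g - u)" "0 \<le> a" "0 \<le> b" "a + b \<le> 1"
    using starE[OF assms(1)] by metis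
  have adj: "adj u v" using fg by (simp add: side_of_def)
  have "a + b \<noteq> 1"
  proof
    assume "a + b = 1"
    then have a: "a = 1 - b" by simp
    have "p = (1 - b) *\<^sub>R ctr f + b *\<^sub>R ctr g" unfolding p(1) a by (simp add: algebra_simps)
    then have "p \<in> convex hull (dual_edge G {u, v})"
      unfolding fg(6) using p a by (auto simp flip: segment_convex_hull simp: in_segment)
    then show False using assms(3) adj by (auto simp: dual_boundary_def)
  qed
  then have ab: "a + b < 1" using p by simp
  consider "a > 0" "b > 0" | "b = 0" "a > 0" | "a = 0" "b > 0" using p assms(2) by fastforce
  then show ?thesis
  proof cases
    case 1
    have "cross (ctr f - u) (v - u) \<noteq> 0"
      using face_line_disjoint[OF fg(1,3) ctr(1)[OF fg(1)]] cross_commute[of "ctr f - u"] by simp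
    then have "p \<in> interior (convex hull {u, ctr f, ctr g})"
      unfolding p(1) using 1 ab cross_neighbour_centers[OF fg(5)] by (intro triangle_interior) auto
    moreover have "convex hull {u, ctr f, ctr g} \<subseteq> star u"
      unfolding star_def using adj fg(6) by force
    ultimately show ?thesis using interior_mono by blast
  next
    case 2
    then show ?thesis using star_ray_interior[OF fg(1,3), of a] p ab by simp
  next
    case 3
    then show ?thesis using star_ray_interior[OF fg(2,4), of b] p ab by simp
  qed
qed

lemma compact_dual_edge_hull:
  assumes "adj u v"
  shows "compact (convex hull (dual_edge G {u, v}))" "compact (convex hull (insert u (dual_edge G {u, v})))"
proof -
  obtain f where f: "f \<in> faces G" "side_of f u v" using adj_side assms by blast
  obtain g where g: "dual_edge G {u, v} = {ctr f, ctr g}"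
    by (rule dual_edge_eq[OF f]) (rule that)
  show "compact (convex hull (dual_edge G {u, v}))" "compact (convex hull (insert u (dual_edge G {u, v})))"
    unfolding g by (intro finite_imp_compact_convex_hull; simp)+
qed

lemma closed_star: "closed (star u)"
  unfolding star_def using finite_neighbours compact_dual_edge_hull
  by (intro closed_UN) (auto intro: compact_imp_closed)

lemma closed_dual_boundary: "closed (dual_boundary u)"
  unfolding dual_boundary_def using finite_neighbours compact_dual_edge_hull
  by (intro closed_UN) (auto intro: compact_imp_closed)

text \<open>A dual edge lies on the perpendicular bisector of its edge.\<close>

lemma dual_boundary_far:
  assumes "p \<in> dual_boundary u" shows "c\<^sub>p * h / 2 \<le> dist u p"
proof -
  obtain v where v: "adj u v" "p \<in> convex hull (dual_edge G {u, v})"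
    using assms by (auto simp: dual_boundary_def)
  obtain f where f: "f \<in> faces G" "side_of f u v" using adj_side v(1) by blast
  obtain g where g: "g \<in> faces G" "side_of g u v" "dual_edge G {u, v} = {ctr f, ctr g}"
    by (rule dual_edge_eq[OF f]) (rule that)
  have half: "inner (ctr k - u) (v - u) = (dist u v)\<^sup>2 / 2" if k: "k \<in> faces G" "side_of k u v" for k
  proof -
    have "(dist (ctr k) u)\<^sup>2 = (dist (ctr k) v)\<^sup>2" using dist_ctr_side[OF k] by simp
    then show ?thesis unfolding dist_norm cmod_power2 inner_complex_def
      by (simp add: power2_eq_square algebra_simps)
  qed
  obtain s where s: "p = (1 - s) *\<^sub>R ctr f + s *\<^sub>R ctr g"
    using v(2) unfolding g(3) by (auto simp flip: segment_convex_hull simp: in_segment)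
  have "p - u = (1 - s) *\<^sub>R (ctr f - u) + s *\<^sub>R (ctr g - u)" unfolding s by (simp add: algebra_simps)
  then have "inner (p - u) (v - u) = (1 - s) * ((dist u v)\<^sup>2 / 2) + s * ((dist u v)\<^sup>2 / 2)"
    by (simp only: inner_add_left inner_scaleR_left half[OF f] half[OF g(1,2)])
  also have "\<dots> = (dist u v)\<^sup>2 / 2" by (simp flip: distrib_right)
  finally have "(dist u v)\<^sup>2 / 2 \<le> norm (p - u) * norm (v - u)" using norm_cauchy_schwarz by metis
  then have "dist u v * (dist u v / 2) \<le> dist u v * dist u p"
    by (simp add: dist_norm norm_minus_commute power2_eq_square mult.commute)
  then have "dist u v / 2 \<le> dist u p" using adjD[OF v(1)] by simp
  then show ?thesis using edge_length_ge'[OF v(1)] by simp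
qed

lemma open_dual_face: "open (dual_face G u)"
  unfolding dual_face_eq by (intro open_connected_component) (auto simp: closed_dual_boundary)

lemma ball_subset_dual_face: "ball u (c\<^sub>p * h / 2) \<subseteq> dual_face G u"
  unfolding dual_face_eq
proof (rule connected_component_maximal)
  show "u \<in> ball u (c\<^sub>p * h / 2)" using cp_pos h_pos by simp
  show "ball u (c\<^sub>p * h / 2) \<subseteq> - dual_boundary u" using dual_boundary_far by force
qed simp

lemma neighbour_exists:
  assumes "u \<in> verts G" obtains v where "adj u v"
proof -
  obtain f where "f \<in> faces G" "u \<in> closure f" using faces_cover by blast
  then obtain v where "side_of f u v" using vert_side assms by blast
  then show ?thesis using that side_of_def by blast
qed

text \<open>Inside the dual face, whose puncture at \<open>u\<close> leaves it connected, the star is both open and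
  closed.\<close>

lemma dual_face_subset_star:
  assumes "u \<in> verts G" shows "dual_face G u \<subseteq> star u"
proof -
  let ?D = "dual_face G u"
  obtain v where v: "adj u v" using neighbour_exists assms by blast
  obtain f where f: "f \<in> faces G" "side_of f u v" using adj_side v by blast
  have uD: "u \<in> ?D" using ball_subset_dual_face[of u] cp_pos h_pos by auto
  have us: "u \<in> star u" unfolding star_def using v by (auto intro!: bexI[of _ v] hull_inc)
  have ne: "ctr f \<noteq> u" using dist_ctr_side[OF f] h_pos by auto
  have "connected (?D - {u})"
    by (rule connected_open_delete[OF open_dual_face]) (simp_all add: dual_face_eq)
  moreover have "(?D - {u}) \<inter> frontier (star u) = {}"
  proof -
    have "?D \<inter> dual_boundary u = {}"
      unfolding dual_face_eq using connected_component_subset[of "- dual_boundary u" u] by blast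
    then show ?thesis using star_interior closed_star[of u]
      by (auto simp: frontier_def closure_closed)
  qed
  moreover have "(?D - {u}) \<inter> star u \<noteq> {}"
  proof -
    \<comment> \<open>The point lies a fraction \<open>a\<close> of the way from \<open>u\<close> to
      a centre at distance \<open>h / 2\<close>: \<open>a < 1\<close> keeps it in the star, and
      \<open>a \<le> c\<^sub>p / 2\<close> in the ball known to lie in the dual face.\<close>
    define a where "a = min (1/2) (c\<^sub>p / 2)"
    have a: "0 < a" "a < 1" "a \<le> c\<^sub>p / 2" using cp_pos by (auto simp: a_def)
    let ?p = "u + a *\<^sub>R (ctr f - u)"
    have "dist u ?p = a * (h / 2)" using dist_ctr_side(1)[OF f] a by (simp add: dist_norm)
    also have "\<dots> \<le> c\<^sub>p / 2 * (h / 2)" using a h_pos by (intro mult_right_mono) auto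
    also have "\<dots> < c\<^sub>p * h / 2" using cp_pos h_pos by simp
    finally have "?p \<in> ?D" using ball_subset_dual_face[of u] by auto
    moreover have "?p \<noteq> u" using a ne by simp
    moreover have "?p \<in> star u" using star_ray_interior[OF f a(1,2)] interior_subset by blast
    ultimately show ?thesis by blast
  qed
  ultimately have "(?D - {u}) - star u = {}" using connected_Int_frontier[of "?D - {u}" "star u"] by blast
  then show ?thesis using us by blast
qed

lemma star_subset_cball: "star u \<subseteq> cball u (h / 2)"
proof
  fix p assume "p \<in> star u"
  then obtain v f g a b where fg: "f \<in> faces G" "g \<in> faces G" "side_of f u v" "side_of g u v"
    and p: "p = u + a *\<^sub>R (ctr f - u) + b *\<^sub>R (ctr g - u)" "0 \<le> a" "0 \<le> b" "a + b \<le> 1"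
    using starE by metis
  have "dist u p = norm (a *\<^sub>R (ctr f - u) + b *\<^sub>R (ctr g - u))"
    unfolding p(1) dist_norm by (subst norm_minus_commute) (simp add: algebra_simps)
  also have "\<dots> \<le> a * norm (ctr f - u) + b * norm (ctr g - u)"
    using p by (intro norm_triangle_le) simp
  also have "\<dots> = (a + b) * (h / 2)"
    using dist_ctr_side(1)[OF fg(1,3)] dist_ctr_side(1)[OF fg(2,4)] by (simp add: dist_norm algebra_simps)
  also have "\<dots> \<le> 1 * (h / 2)" using p h_pos by (intro mult_right_mono) auto
  finally show "p \<in> cball u (h / 2)" by simp
qed

lemma dual_area_bounds:
  assumes "u \<in> verts G"
  shows "pi * (c\<^sub>p * h / 2)\<^sup>2 \<le> dual_area G u" "dual_area G u \<le> pi * h\<^sup>2"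
proof -
  have sub: "dual_face G u \<subseteq> ball u h"
    using dual_face_subset_star[OF assms] star_subset_cball[of u] h_pos by force
  have m: "dual_face G u \<in> lmeasurable"
    using bounded_subset[OF bounded_ball sub] open_dual_face by (intro lmeasurable_open) auto
  show "pi * (c\<^sub>p * h / 2)\<^sup>2 \<le> dual_area G u"
    using measure_mono_fmeasurable[OF ball_subset_dual_face _ m] cp_pos h_pos
    by (simp add: dual_area_def content_ball_complex)
  show "dual_area G u \<le> pi * h\<^sup>2"
    using measure_mono_fmeasurable[OF sub _ lmeasurable_ball] m h_pos
    by (simp add: dual_area_def content_ball_complex fmeasurableD)
qed

text \<open>The half \<open>b \<le> a\<close> of the dual triangle has corners \<open>u\<close>,
  \<open>ctr f\<close> and the midpoint of the edge, so it lies in the closed convex face. A vertex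
  there is at distance \<open>h / 2\<close> from \<open>ctr f\<close>, and in this half only
  \<open>u\<close> is that far away, as the midpoint of a chord is strictly inside the
  circle.\<close>

lemma vert_in_triangle:
  assumes "f \<in> faces G" "side_of f u v" "ctr g = u + v - ctr f" "w \<in> verts G"
    and w: "w = u + a *\<^sub>R (ctr f - u) + b *\<^sub>R (ctr g - u)" and ab: "0 \<le> b" "b \<le> a" "a + b \<le> 1"
  shows "w = u"
proof -
  let ?m = "midpoint u v"
  have uv: "u \<noteq> v" using assms(2) adjD by (auto simp: side_of_def)
  have mid: "?m \<in> open_segment u v" using uv by simp
  have "closed_segment u v \<subseteq> closure f" using assms(2) by (auto simp: side_of_def frontier_def)
  then have cl: "u \<in> closure f" "?m \<in> closure f" "ctr f \<in> closure f"
    using mid closure_subset[of f] ctr(1)[OF assms(1)] by (auto simp: open_segment_def)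
  have m2: "2 *\<^sub>R (?m - u) = v - u" 
    by (simp add: midpoint_def scaleR_2 algebra_simps)
  have cg: "ctr g - u = 2 *\<^sub>R (?m - u) - (ctr f - u)" unfolding m2 using assms(3) by simp
  have "u + a *\<^sub>R p + b *\<^sub>R (2 *\<^sub>R q - p) = u + (a - b) *\<^sub>R p + (2 * b) *\<^sub>R q" for p q
    by (simp add: complex_eq_iff algebra_simps)
  then have w': "w = u + (a - b) *\<^sub>R (ctr f - u) + (2 * b) *\<^sub>R (?m - u)"
    unfolding w cg by blast
  have "w \<in> convex hull {u, ctr f, ?m}"
    unfolding convex_hull_3_alt using w' ab by (intro CollectI exI[of _ "a - b"] exI[of _ "2 * b"]) auto
  also have "\<dots> \<subseteq> closure f"
    using cl by (intro hull_minimal convex_closure convex_face assms) auto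
  finally have "w \<in> frontier f" using skeleton_frontier assms by (auto simp: skeleton_def)
  then have dw: "dist (ctr f) w = h / 2" using ctr(2)[OF assms(1)] assms(4) by (auto simp: face_verts_def)
  \<comment> \<open>Relative to \<open>ctr f\<close> the barycentric weight \<open>a - b\<close>
    drops out; only \<open>u\<close> and the midpoint contribute to the distance.\<close>
  have "u + (a - b) *\<^sub>R (c - u) + (2 * b) *\<^sub>R (m - u) - c
      = (1 - a - b) *\<^sub>R (u - c) + (2 * b) *\<^sub>R (m - c)" for c m
    by (simp add: complex_eq_iff algebra_simps)
  then have "w - ctr f = (1 - a - b) *\<^sub>R (u - ctr f) + (2 * b) *\<^sub>R (?m - ctr f)"
    unfolding w' by blast
  then have "norm (w - ctr f) \<le> (1 - a - b) * norm (u - ctr f) + 2 * b * norm (?m - ctr f)"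
    using norm_triangle_ineq[of "(1 - a - b) *\<^sub>R (u - ctr f)" "(2 * b) *\<^sub>R (?m - ctr f)"] ab by simp
  then have "dist (ctr f) w \<le> (1 - a - b) * dist (ctr f) u + 2 * b * dist (ctr f) ?m"
    by (simp only: dist_norm norm_minus_commute)
  then have dw': "dist (ctr f) w \<le> (1 - a - b) * (h / 2) + 2 * b * dist (ctr f) ?m"
    unfolding dist_ctr_side(1)[OF assms(1,2)] .
  have dm: "dist (ctr f) ?m < h / 2"
    using dist_less_chord[OF dist_ctr_side[OF assms(1,2)] mid] .
  have "b = 0"
  proof (rule ccontr)
    assume "b \<noteq> 0"
    then have "2 * b * dist (ctr f) ?m < 2 * b * (h / 2)" using ab dm by simp
    moreover have "(1 - a - b) * (h / 2) + 2 * b * (h / 2) = (1 - (a - b)) * (h / 2)"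
      by (simp add: field_simps)
    moreover have "(1 - (a - b)) * (h / 2) \<le> 1 * (h / 2)" using ab h_pos by (intro mult_right_mono) auto
    ultimately show False using dw dw' by linarith
  qed
  then have "h / 2 \<le> (1 - a) * (h / 2)" using dw dw' by simp
  then have "a \<le> 0" using h_pos by (simp add: left_diff_distrib mult_le_0_iff)
  then show ?thesis using w' ab \<open>b = 0\<close> by simp
qed

text \<open>The bound on edge lengths concerns adjacent vertices only. Any closer vertex would lie
  in the dual face of \<open>u\<close>, hence in a triangle of the star, and each half of that
  triangle belongs to one of the two faces at the edge.\<close>

lemma verts_separated:
  assumes "u \<in> verts G" "w \<in> verts G" "u \<noteq> w"
  shows "c\<^sub>p * h / 2 \<le> dist u w"
proof (rule ccontr)
  assume "\<not> ?thesis"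
  then have "w \<in> dual_face G u" using ball_subset_dual_face[of u] by auto
  then have "w \<in> star u" using dual_face_subset_star assms(1) by blast
  then obtain v f g a b where fg: "f \<in> faces G" "g \<in> faces G" "side_of f u v" "side_of g u v"
    "ctr g = u + v - ctr f" "dual_edge G {u, v} = {ctr f, ctr g}"
    and w: "w = u + a *\<^sub>R (ctr f - u) + b *\<^sub>R (ctr g - u)" "0 \<le> a" "0 \<le> b" "a + b \<le> 1"
    using starE by metis
  show False
  proof (cases "b \<le> a")
    case True
    then show False using vert_in_triangle[OF fg(1,3,5) assms(2) w(1)] w assms(3) by simp
  next
    case False
    have e: "ctr f = u + v - ctr g" "w = u + b *\<^sub>R (ctr g - u) + a *\<^sub>R (ctr f - u)"
      using fg(5) w(1) by auto
    have "w = u" by (rule vert_in_triangle[OF fg(2,4) e(1) assms(2) e(2)]) (use w False in linarith)+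
    then show False using assms(3) by simp
  qed
qed

section \<open>Packing and the bounds for degrees and rates\<close>

text \<open>The ratio of the areas of discs with radii \<open>\<rho> * h + s\<close> and
  \<open>s\<close>, where \<open>s = c\<^sub>p * h / 4\<close> is half the separation of the
  vertices. It does not depend on \<open>h\<close>.\<close>

definition packing :: "real \<Rightarrow> real" where
  "packing \<rho> = (4 * \<rho> / c\<^sub>p + 1)\<^sup>2"

lemma packing_nonneg: "0 \<le> packing \<rho>"
  by (simp add: packing_def)

lemma card_verts_le:
  assumes "W \<subseteq> verts G" "W \<subseteq> cball p (\<rho> * h)" "\<rho> \<ge> 0"
  shows "finite W" "card W \<le> packing \<rho>"
proof -
  show fin: "finite W"
    by (rule finite_subset[OF _ finite_verts_Int[of "cball p (\<rho> * h)"]]) (use assms in auto)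
  define s where "s = c\<^sub>p * h / 4"
  have s: "s > 0" using cp_pos h_pos by (simp add: s_def)
  have "disjoint_family_on (\<lambda>w. ball w s) W"
    unfolding disjoint_family_on_def
  proof (intro ballI impI)
    fix a b assume ab: "a \<in> W" "b \<in> W" "a \<noteq> b"
    then have "2 * s \<le> dist a b" using verts_separated[of a b] assms(1) by (auto simp: s_def)
    then show "ball a s \<inter> ball b s = {}" by (intro disjoint_ballI) simp
  qed
  moreover have "emeasure lborel (ball w s) \<noteq> \<infinity>" for w :: complex
    using emeasure_lborel_ball_finite[of w s] by auto
  ultimately have "measure lborel (\<Union>w\<in>W. ball w s) = (\<Sum>w\<in>W. measure lborel (ball w s))"
    using fin by (intro measure_finite_Union) auto
  also have "\<dots> = card W * (pi * s\<^sup>2)" using s by (simp add: content_ball_complex)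
  finally have 1: "measure lborel (\<Union>w\<in>W. ball w s) = card W * (pi * s\<^sup>2)" .
  have "measure lborel (\<Union>w\<in>W. ball w s) \<le> measure lborel (ball p (\<rho> * h + s))"
  proof (rule measure_mono_fmeasurable)
    show "(\<Union>w\<in>W. ball w s) \<subseteq> ball p (\<rho> * h + s)"
    proof
      fix x assume "x \<in> (\<Union>w\<in>W. ball w s)"
      then obtain w where "w \<in> W" "dist w x < s" by auto
      then have "dist p w \<le> \<rho> * h" "dist w x < s" using assms(2) by auto
      then show "x \<in> ball p (\<rho> * h + s)" using dist_triangle[of p x w] by simp
    qed
    show "ball p (\<rho> * h + s) \<in> fmeasurable lborel"
      using emeasure_lborel_ball_finite by (auto simp: fmeasurable_def)
  qed (auto intro!: sets.finite_UN fin)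
  also have "\<dots> = pi * (\<rho> * h + s)\<^sup>2" using s assms(3) h_pos by (intro content_ball_complex) simp
  finally have "card W * s\<^sup>2 \<le> (\<rho> * h + s)\<^sup>2" unfolding 1 by simp
  also have "\<rho> * h + s = (4 * \<rho> / c\<^sub>p + 1) * s" using cp_pos by (simp add: s_def field_simps)
  finally show "card W \<le> packing \<rho>" using s by (simp add: packing_def power_mult_distrib)
qed

lemma card_neighbours_le: assumes "u \<in> verts G" shows "card {v. adj u v} \<le> packing 1"
  by (rule card_verts_le(2)[of _ u]) (use adjD edge_length_le in auto)

lemma vertex_weight_bounds:
  assumes "u \<in> verts G"
  shows "c\<^sub>d \<le> vertex_weight G u" "vertex_weight G u \<le> packing 1 / c\<^sub>p"
proof -
  obtain v where v: "adj u v" using neighbour_exists assms by blast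
  have "c\<^sub>d \<le> edge_weight G u v" using edge_weight_bounds v by blast
  also have "\<dots> \<le> vertex_weight G u" unfolding vertex_weight_def
    using v finite_neighbours edge_weight_bounds(1) cd_pos
    by (intro member_le_sum) (auto intro: order.trans less_imp_le)
  finally show "c\<^sub>d \<le> vertex_weight G u" .
  have "vertex_weight G u \<le> card {v. adj u v} * (1 / c\<^sub>p)"
    unfolding vertex_weight_def using edge_weight_bounds(2) by (intro sum_bounded_above) auto
  also have "\<dots> \<le> packing 1 * (1 / c\<^sub>p)"
    using card_neighbours_le[OF assms] cp_pos by (intro mult_right_mono) auto
  finally show "vertex_weight G u \<le> packing 1 / c\<^sub>p" by simp
qed

text \<open>The constants combine the bounds \<open>c\<^sub>d\<close> and
  \<open>packing 1 / c\<^sub>p\<close> of the vertex weights with the areas of the discs of radius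
  \<open>h\<close> and \<open>c\<^sub>p * h / 2\<close> around and inside the dual face.\<close>

lemma jump_rate_bounds:
  assumes "u \<in> verts G"
  shows "c\<^sub>d / (2 * pi) / h\<^sup>2 \<le> jump_rate G u"
    "jump_rate G u \<le> 2 * packing 1 / (pi * c\<^sub>p ^ 3) / h\<^sup>2"
proof -
  note w = vertex_weight_bounds[OF assms] and a = dual_area_bounds[OF assms]
  have pos: "0 < pi * (c\<^sub>p * h / 2)\<^sup>2" using cp_pos h_pos by simp
  have "c\<^sub>d / (2 * (pi * h\<^sup>2)) \<le> jump_rate G u"
    unfolding jump_rate_def using w a pos cd_pos by (intro frac_le) auto
  then show "c\<^sub>d / (2 * pi) / h\<^sup>2 \<le> jump_rate G u" by (simp add: mult.assoc)
  have "jump_rate G u \<le> (packing 1 / c\<^sub>p) / (2 * (pi * (c\<^sub>p * h / 2)\<^sup>2))"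
    unfolding jump_rate_def using w a pos cd_pos by (intro frac_le) auto
  also have "\<dots> = 2 * packing 1 / (pi * c\<^sub>p ^ 3) / h\<^sup>2"
    using cp_pos h_pos by (simp add: field_simps power2_eq_square power3_eq_cube)
  finally show "jump_rate G u \<le> 2 * packing 1 / (pi * c\<^sub>p ^ 3) / h\<^sup>2" .
qed

lemma jump_prob_ge:
  assumes "adj u v"
  shows "c\<^sub>d * c\<^sub>p / packing 1 \<le> edge_weight G u v / vertex_weight G u"
proof -
  have u: "u \<in> verts G" using adjD assms by blast
  have "c\<^sub>d / (packing 1 / c\<^sub>p) \<le> edge_weight G u v / vertex_weight G u"
    using vertex_weight_bounds[OF u] edge_weight_bounds[OF assms] cd_pos by (intro frac_le) auto
  then show ?thesis by simp
qed

section \<open>Walks along a segment\<close>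

lemma face_vertsI: "f \<in> faces G \<Longrightarrow> u \<in> verts G \<Longrightarrow> u \<in> closure f \<Longrightarrow> u \<in> face_verts G f"
  using skeleton_frontier by (auto simp: face_verts_def skeleton_def)

text \<open>Distinct faces touch only in their frontiers, and the two sides through the common point
  are equal or have that point as a common end. The case \<open>f = g\<close> provides a vertex of
  an arbitrary face.\<close>

lemma touching_faces_share_vertex:
  assumes "f \<in> faces G" "g \<in> faces G" "p \<in> closure f" "p \<in> closure g"
  obtains w where "w \<in> face_verts G f" "w \<in> face_verts G g"
proof (cases "f = g")
  case True
  obtain v where "v \<in> frontier f"
    using assms(1) faceD[OF assms(1)] by (metis bounded_empty connected_component_eq_UNIV
      frontier_eq_empty not_bounded_UNIV ex_in_conv)
  then show ?thesis using that side_of_verts frontier_side assms(1) True by metis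
next
  case False
  have *: "p \<in> frontier k" if k: "k \<in> faces G" "l \<in> faces G" "k \<noteq> l" "p \<in> closure k" "p \<in> closure l" for k l
  proof -
    have "p \<notin> k"
    proof
      assume "p \<in> k"
      then have "k \<inter> l \<noteq> {}"
        using open_Int_closure_eq_empty[OF open_face[OF k(1)], of l] k by blast
      then show False using face_unique k by blast
    qed
    then show ?thesis using k open_face by (simp add: frontier_def interior_open)
  qed
  obtain a b where ab: "side_of f a b" "p \<in> closed_segment a b"
    using frontier_side *[OF assms(1,2) False assms(3,4)] assms(1) by blast
  obtain a' b' where ab': "side_of g a' b'" "p \<in> closed_segment a' b'"
    using frontier_side *[OF assms(2,1) not_sym[OF False] assms(4,3)] assms(2) by blast
  show ?thesis
  proof (cases "{a, b} = {a', b'}")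
    case True
    then show ?thesis using that[of a] side_of_verts[OF ab(1)] side_of_verts[OF ab'(1)]
      by (auto simp: doubleton_eq_iff)
  next
    case False
    then have "p \<in> {a, b} \<inter> {a', b'}" using edges_inter[of a b a' b' p] ab ab' False
      by (simp add: side_of_def)
    then show ?thesis using that[of p] side_of_verts[OF ab(1)] side_of_verts[OF ab'(1)] by auto
  qed
qed

text \<open>The vertices of the faces that meet a segment are joined by walks through such faces, and
  there are only \<open>O(dist u v / h)\<close> of them.\<close>

lemma graph_dist_bound:
  assumes "u \<in> verts G" "v \<in> verts G"
  obtains n and w :: "nat \<Rightarrow> complex" where "w 0 = u" "w n = v" "\<And>i. i < n \<Longrightarrow> adj (w i) (w (Suc i))"
    "n \<le> (dist u v / h + 3) * packing 2 * packing 1"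
proof -
  define S where "S = closed_segment u v"
  define F where "F = {f \<in> faces G. closure f \<inter> S \<noteq> {}}"
  define W where "W = {w \<in> verts G. \<exists>s\<in>S. dist s w \<le> h}"
  \<comment> \<open>Reachability in this finite relation takes at most \<open>card E\<close> steps,
    which is where the bound on \<open>n\<close> comes from.\<close>
  define E where "E = {(a, b). a \<in> W \<and> b \<in> W \<and> adj a b}"
  have W: "finite W" "card W \<le> (dist u v / h + 3) * packing 2"
  proof -
    \<comment> \<open>The points \<open>q k\<close> are spaced by at most \<open>h\<close> along the
      segment, so every point of \<open>W\<close> is within \<open>2 * h\<close> of one of them. The
      summand 1 keeps \<open>N\<close> positive if \<open>u = v\<close>.\<close>
    define N where "N = nat \<lceil>dist u v / h\<rceil> + 1"
    have N: "N > 0" "dist u v / h \<le> N" "N \<le> dist u v / h + 2" using h_pos by (auto simp: N_def) linarith+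
    define q where "q = (\<lambda>k::nat. u + (k / N) *\<^sub>R (v - u))"
    define B where "B = (\<lambda>k. verts G \<inter> cball (q k) (2 * h))"
    have B: "finite (B k)" "card (B k) \<le> packing 2" for k
      using card_verts_le[of "B k" "q k" 2] by (auto simp: B_def)
    have sub: "W \<subseteq> (\<Union>k\<in>{..N}. B k)"
    proof
      fix w assume "w \<in> W"
      then obtain s where s: "w \<in> verts G" "s \<in> S" "dist s w \<le> h" by (auto simp: W_def)
      obtain x where x: "0 \<le> x" "x \<le> 1" "s = u + x *\<^sub>R (v - u)"
        using s(2) by (auto simp: S_def in_segment algebra_simps)
      define k where "k = nat \<lfloor>x * N\<rfloor>"
      have k: "k \<le> x * N" "x * N \<le> k + 1" using x by (auto simp: k_def) linarith+
      have "x * N \<le> 1 * real N" using x by (intro mult_right_mono) auto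
      then have kN: "k \<le> N" using k by linarith
      have "x - k / N = (x * N - k) / N" using N(1) by (simp add: field_simps)
      then have "\<bar>x - k / N\<bar> \<le> 1 / N" using k N(1) by (simp add: divide_right_mono)
      moreover have "s - q k = (x - k / N) *\<^sub>R (v - u)" by (simp add: x(3) q_def algebra_simps)
      ultimately have "dist (q k) s \<le> (1 / N) * dist u v"
        using mult_right_mono[of "\<bar>x - k / N\<bar>" "1 / N" "norm (v - u)"]
        by (simp add: dist_norm norm_minus_commute)
      also have "\<dots> \<le> h" using N(1,2) h_pos by (simp add: field_simps)
      finally have "dist (q k) w \<le> 2 * h" using dist_triangle[of "q k" w s] s(3) by simp
      then show "w \<in> (\<Union>k\<in>{..N}. B k)" using kN s(1) by (auto simp: B_def)
    qed
    show "finite W" using finite_subset[OF sub] B by simp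
    have "card W \<le> card (\<Union>k\<in>{..N}. B k)" using sub B by (intro card_mono) auto
    also have "\<dots> \<le> (\<Sum>k\<le>N. card (B k))" by (rule card_UN_le) simp
    finally have "real (card W) \<le> real (\<Sum>k\<le>N. card (B k))" by (rule of_nat_mono)
    also have "\<dots> = (\<Sum>k\<le>N. real (card (B k)))" by simp
    also have "\<dots> \<le> (\<Sum>k\<le>N. packing 2)" using B by (intro sum_mono) auto
    also have "\<dots> = (real N + 1) * packing 2" by simp
    also have "\<dots> \<le> (dist u v / h + 3) * packing 2" using N packing_nonneg by (intro mult_right_mono) auto
    finally show "card W \<le> (dist u v / h + 3) * packing 2" .
  qed
  have E: "finite E" "card E \<le> (dist u v / h + 3) * packing 2 * packing 1"
  proof -
    have sub: "E \<subseteq> Sigma W (\<lambda>a. {b. adj a b})" by (auto simp: E_def)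
    show "finite E" using finite_subset[OF sub] W(1) finite_neighbours by simp
    have "card E \<le> (\<Sum>a\<in>W. card {b. adj a b})"
      using card_mono[OF _ sub] W(1) finite_neighbours by (simp add: card_SigmaI)
    then have "real (card E) \<le> real (\<Sum>a\<in>W. card {b. adj a b})" by (rule of_nat_mono)
    also have "\<dots> = (\<Sum>a\<in>W. real (card {b. adj a b}))" by simp
    also have "\<dots> \<le> (\<Sum>a\<in>W. packing 1)" using card_neighbours_le by (intro sum_mono) (auto simp: W_def)
    also have "\<dots> = card W * packing 1" by simp
    also have "\<dots> \<le> (dist u v / h + 3) * packing 2 * packing 1"
      using W(2) packing_nonneg by (intro mult_right_mono) auto
    finally show "card E \<le> (dist u v / h + 3) * packing 2 * packing 1" .
  qed
  have "sym E" using adj_commute by (auto simp: E_def sym_def)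
  then have symE: "(b, a) \<in> E\<^sup>*" if "(a, b) \<in> E\<^sup>*" for a b
    using sym_rtrancl[of E] that by (auto simp: sym_def)
  have FW: "face_verts G f \<subseteq> W" if f: "f \<in> F" for f
  proof
    fix w assume w: "w \<in> face_verts G f"
    obtain s where s: "s \<in> closure f" "s \<in> S" and fF: "f \<in> faces G" using f by (auto simp: F_def)
    have "w \<in> closure f" "w \<in> verts G" using w by (auto simp: face_verts_def frontier_def)
    then have "dist (ctr f) w \<le> h / 2" "dist (ctr f) s \<le> h / 2"
      using face_subset_cball[OF fF] s by auto
    then have "dist s w \<le> h" using dist_triangle[of s w "ctr f"] by (simp add: dist_commute)
    then show "w \<in> W" using s \<open>w \<in> verts G\<close> by (auto simp: W_def)
  qed
  have Fconn: "(a, b) \<in> E\<^sup>*" if f: "f \<in> F" "a \<in> face_verts G f" "b \<in> face_verts G f" for f a b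
  proof -
    have fF: "f \<in> faces G" using f(1) by (simp add: F_def)
    obtain vs where vs: "length vs \<ge> 3" "distinct vs"
      "\<And>i. i < length vs \<Longrightarrow> side_of f (vs ! i) (vs ! (Suc i mod length vs))"
      "frontier f = (\<Union>i<length vs. closed_segment (vs ! i) (vs ! (Suc i mod length vs)))"
      using polygon fF by blast
    have set: "face_verts G f = set vs" by (rule face_verts_eq_set[OF fF vs(1,3,4)])
    have from0: "i < length vs \<Longrightarrow> (vs ! 0, vs ! i) \<in> E\<^sup>*" for i
    proof (induction i)
      case (Suc i)
      then have "side_of f (vs ! i) (vs ! Suc i)" using vs(3)[of i] by simp
      then have "(vs ! i, vs ! Suc i) \<in> E"
        using side_of_verts FW[OF f(1)] by (auto simp: E_def side_of_def)
      then show ?case using Suc by (auto intro: rtrancl_into_rtrancl)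
    qed simp
    obtain i j where "i < length vs" "j < length vs" "a = vs ! i" "b = vs ! j"
      using f(2,3) unfolding set by (auto simp: in_set_conv_nth)
    then show ?thesis using from0 symE by (meson rtrancl_trans)
  qed
  \<comment> \<open>Finiteness makes the unions of closed faces below closed sets. It holds because
    each edge is a side of two faces only.\<close>
  have finF: "finite F"
  proof -
    have "F \<subseteq> (\<Union>(a, b)\<in>E. {k \<in> faces G. side_of k a b})"
    proof
      fix f assume f: "f \<in> F"
      then have fF: "f \<in> faces G" by (simp add: F_def)
      obtain w where "w \<in> face_verts G f"
        using touching_faces_share_vertex[OF fF fF, of "ctr f"] ctr(1)[OF fF] closure_subset[of f] by blast
      then obtain b where "side_of f w b"
        using vert_side[OF fF, of w] by (auto simp: face_verts_def frontier_def)
      then have "(w, b) \<in> E" "side_of f w b"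
        using side_of_verts[of f w b] FW[OF f] by (auto simp: E_def side_of_def)
      then show "f \<in> (\<Union>(a, b)\<in>E. {k \<in> faces G. side_of k a b})" using fF by auto
    qed
    moreover have "finite (case e of (a, b) \<Rightarrow> {k \<in> faces G. side_of k a b})" if e: "e \<in> E" for e
    proof -
      obtain a b where ab: "e = (a, b)" "adj a b" using e by (auto simp: E_def)
      obtain f g where "{k \<in> faces G. side_of k a b} = {f, g}" using ab(2) by (rule edge_faces)
      then show ?thesis using ab(1) by simp
    qed
    then have "finite (\<Union>(a, b)\<in>E. {k \<in> faces G. side_of k a b})" using E(1) by blast
    ultimately show ?thesis by (rule finite_subset)
  qed
  \<comment> \<open>The faces reached from \<open>u\<close>. Touching faces share a vertex, so
    closed faces in \<open>A\<close> and in \<open>F - A\<close> are disjoint, and connectedness of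
    the segment leaves no part of it to \<open>F - A\<close>.\<close>
  define A where "A = {f \<in> F. \<forall>w\<in>face_verts G f. (u, w) \<in> E\<^sup>*}"
  have fin: "finite A" "finite (F - A)" using finF by (auto simp: A_def)
  have uS: "u \<in> S" "v \<in> S" by (auto simp: S_def)
  have cover: "S \<subseteq> (\<Union>f\<in>A. closure f) \<union> (\<Union>f\<in>F - A. closure f)"
  proof
    fix p assume p: "p \<in> S"
    obtain f where "f \<in> faces G" "p \<in> closure f" using faces_cover by blast
    then have "f \<in> F" using p by (auto simp: F_def)
    then show "p \<in> (\<Union>f\<in>A. closure f) \<union> (\<Union>f\<in>F - A. closure f)" using \<open>p \<in> closure f\<close> by auto
  qed
  have inA: "f \<in> A" if f: "f \<in> F" "(u, w) \<in> E\<^sup>*" "w \<in> face_verts G f" for f w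
    using Fconn[OF f(1,3)] f by (auto simp: A_def intro: rtrancl_trans)
  have disj: "(\<Union>f\<in>A. closure f) \<inter> (\<Union>f\<in>F - A. closure f) \<inter> S = {}"
  proof (rule ccontr)
    assume "\<not> ?thesis"
    then obtain f g p where fg: "f \<in> A" "g \<in> F" "g \<notin> A" "p \<in> closure f" "p \<in> closure g" by blast
    then have "f \<in> faces G" "g \<in> faces G" by (auto simp: A_def F_def)
    then obtain w where "w \<in> face_verts G f" "w \<in> face_verts G g"
      using touching_faces_share_vertex fg(4,5) by blast
    then have "g \<in> A" using inA[OF fg(2)] fg(1) by (auto simp: A_def)
    then show False using fg(3) by simp
  qed
  have meets: "(\<Union>f\<in>A. closure f) \<inter> S \<noteq> {}"
  proof -
    obtain f where f: "f \<in> faces G" "u \<in> closure f" using faces_cover by blast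
    then have "f \<in> F" using uS by (auto simp: F_def)
    then have "f \<in> A" using inA[of f u] face_vertsI f assms(1) by simp
    then show ?thesis using f uS by blast
  qed
  have "connected S" by (simp add: S_def)
  then have "(\<Union>f\<in>F - A. closure f) \<inter> S = {}"
    using fin cover disj meets unfolding connected_closed by (meson closed_UN closed_closure)
  then obtain f where f: "f \<in> A" "v \<in> closure f" using cover uS by blast
  then have "v \<in> face_verts G f" using face_vertsI assms(2) by (simp add: A_def F_def)
  then have "(u, v) \<in> E\<^sup>*" using f by (simp add: A_def)
  then obtain n where n: "n \<le> card E" "(u, v) \<in> E ^^ n"
    unfolding rtrancl_finite_eq_relpow[OF E(1)] by blast
  then obtain w where "w 0 = u" "w n = v" "\<forall>i<n. (w i, w (Suc i)) \<in> E"
    by (auto simp: relpow_fun_conv)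
  moreover have "real n \<le> (dist u v / h + 3) * packing 2 * packing 1" using n E(2) by linarith
  ultimately show ?thesis using that[of w n] by (auto simp: E_def)
qed

end

section \<open>Transition probabilities of the random walk\<close>

text \<open>The density decreases on the interval, so its value at \<open>q\<close> is a lower
  bound.\<close>

lemma emeasure_exponential_ge:
  assumes "0 < l" "0 \<le> p" "p \<le> q"
  shows "ennreal ((q - p) * l * exp (- q * l)) \<le> emeasure (density lborel (\<lambda>s. ennreal (exponential_density l s))) {p<..q}"
proof -
  have "ennreal ((q - p) * l * exp (- q * l)) = ennreal (l * exp (- q * l)) * emeasure lborel {p<..q}"
    using assms by (simp add: ennreal_mult[symmetric] mult_ac)
  also have "\<dots> = (\<integral>\<^sup>+ s. ennreal (l * exp (- q * l)) * indicator {p<..q} s \<partial>lborel)"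
    by (simp add: nn_integral_cmult_indicator)
  also have "\<dots> \<le> (\<integral>\<^sup>+ s. ennreal (exponential_density l s) * indicator {p<..q} s \<partial>lborel)"
    using assms by (intro nn_integral_mono) 
      (auto simp: exponential_density_def mult_right_mono split: split_indicator intro!: ennreal_leI)
  also have "\<dots> = emeasure (density lborel (\<lambda>s. ennreal (exponential_density l s))) {p<..q}"
    by (simp add: emeasure_density)
  finally show ?thesis .
qed

text \<open>Exponential tilting: the density of rate \<open>l\<close> times
  \<open>exp (- \<theta> * s)\<close> is \<open>l / (l + \<theta>)\<close> times the density of rate
  \<open>l + \<theta>\<close>.\<close>

lemma nn_integral_exponential_laplace:
  assumes "0 < l" "0 < \<theta>"
  shows "(\<integral>\<^sup>+ s. ennreal (exp (- \<theta> * s)) \<partial>density lborel (\<lambda>s. ennreal (exponential_density l s))) = ennreal (l / (l + \<theta>))"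
proof -
  interpret prob_space "density lborel (\<lambda>s. ennreal (exponential_density (l + \<theta>) s))"
    using prob_space_exponential_density[of "l + \<theta>"] assms by simp
  have "exponential_density l s * exp (- \<theta> * s) = l / (l + \<theta>) * exponential_density (l + \<theta>) s" for s
  proof -
    have "exp (- s * l) * exp (- \<theta> * s) = exp (- s * (l + \<theta>))"
      by (simp add: algebra_simps flip: exp_add)
    then show ?thesis using assms by (simp add: exponential_density_def)
  qed
  then have e: "ennreal (exponential_density l s) * ennreal (exp (- \<theta> * s))
      = ennreal (l / (l + \<theta>)) * ennreal (exponential_density (l + \<theta>) s)" for s
    using assms by (simp add: exponential_density_nonneg flip: ennreal_mult)
  have "(\<integral>\<^sup>+ s. ennreal (exp (- \<theta> * s)) \<partial>density lborel (\<lambda>s. ennreal (exponential_density l s)))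
      = (\<integral>\<^sup>+ s. ennreal (exponential_density l s) * ennreal (exp (- \<theta> * s)) \<partial>lborel)"
    by (rule nn_integral_density) simp_all
  also have "\<dots> = (\<integral>\<^sup>+ s. ennreal (l / (l + \<theta>)) * ennreal (exponential_density (l + \<theta>) s) \<partial>lborel)"
    by (simp only: e)
  also have "\<dots> = ennreal (l / (l + \<theta>)) * emeasure (density lborel (\<lambda>s. ennreal (exponential_density (l + \<theta>) s))) UNIV"
    by (subst nn_integral_cmult) (simp_all add: emeasure_density)
  also have "\<dots> = ennreal (l / (l + \<theta>))" using emeasure_space_1 by simp
  finally show ?thesis .
qed

text \<open>The interface between geometry and probability. The application takes \<open>a\<close>
  and \<open>b\<close> of order \<open>1 / h\<^sup>2\<close>, with \<open>\<delta>\<close> and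
  \<open>K\<close> independent of \<open>h\<close>.\<close>

locale walk_bounds =
  fixes G :: plane_graph and a b \<delta> K :: real
  assumes countable_verts: "countable (verts G)"
    and edge_verts: "{u, v} \<in> edges G \<Longrightarrow> v \<in> verts G"
    and finite_nbrs: "u \<in> verts G \<Longrightarrow> finite {v. {u, v} \<in> edges G}"
    and card_nbrs: "u \<in> verts G \<Longrightarrow> card {v. {u, v} \<in> edges G} \<le> K"
    and edge_weight_nonneg: "{u, v} \<in> edges G \<Longrightarrow> 0 \<le> edge_weight G u v"
    and vertex_weight_pos: "u \<in> verts G \<Longrightarrow> 0 < vertex_weight G u"
    and jump_prob: "{u, v} \<in> edges G \<Longrightarrow> \<delta> \<le> edge_weight G u v / vertex_weight G u"
    and rate_ge: "u \<in> verts G \<Longrightarrow> a \<le> jump_rate G u"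
    and rate_le: "u \<in> verts G \<Longrightarrow> jump_rate G u \<le> b"
    and a_pos: "0 < a" and \<delta>_pos: "0 < \<delta>" and K_nonneg: "0 \<le> K"
begin

abbreviation "exp_law u \<equiv> density lborel (\<lambda>s. ennreal (exponential_density (jump_rate G u) s))"
abbreviation "step_law u \<equiv> measure_pmf (jump_pmf G u) \<Otimes>\<^sub>M exp_law u"
abbreviation "\<Omega> \<equiv> walk_space G"

lemma walk_space_eq: "\<Omega> = PiM (UNIV \<times> verts G) (\<lambda>i. step_law (snd i))"
  unfolding walk_space_def by (intro PiM_cong) auto

lemma rate_pos: "u \<in> verts G \<Longrightarrow> 0 < jump_rate G u"
  using rate_ge a_pos by fastforce

lemma prob_exp_law: "u \<in> verts G \<Longrightarrow> prob_space (exp_law u)"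
  using prob_space_exponential_density rate_pos by simp

lemma prob_step_law: "u \<in> verts G \<Longrightarrow> prob_space (step_law u)"
  by (intro prob_space_pair prob_exp_law) (auto intro: prob_space_measure_pmf)

lemma prob_walk_space: "prob_space \<Omega>"
  unfolding walk_space_eq by (rule prob_space_PiM) (auto intro: prob_step_law)

lemma pmf_jump:
  assumes u: "u \<in> verts G"
  shows "pmf (jump_pmf G u) v = (if {u, v} \<in> edges G then edge_weight G u v / vertex_weight G u else 0)"
  unfolding jump_pmf_def
proof (rule pmf_embed_pmf)
  let ?f = "\<lambda>v. if {u, v} \<in> edges G then edge_weight G u v / vertex_weight G u else 0"
  have nn: "0 \<le> ?f v" for v
    using edge_weight_nonneg vertex_weight_pos[OF u] by simp
  show "0 \<le> ?f v" for v by (rule nn)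
  have "(\<integral>\<^sup>+ v. ennreal (?f v) \<partial>count_space UNIV) = (\<Sum>v | {u, v} \<in> edges G. ennreal (?f v))"
    by (rule nn_integral_count_space') (use finite_nbrs[OF u] in auto)
  also have "\<dots> = ennreal (\<Sum>v | {u, v} \<in> edges G. ?f v)" by (rule sum_ennreal) (rule nn)
  also have "(\<Sum>v | {u, v} \<in> edges G. ?f v) = (\<Sum>v | {u, v} \<in> edges G. edge_weight G u v / vertex_weight G u)"
    by (intro sum.cong) auto
  also have "\<dots> = (\<Sum>v | {u, v} \<in> edges G. edge_weight G u v) / vertex_weight G u"
    by (simp add: sum_divide_distrib)
  also have "\<dots> = 1" using vertex_weight_pos[OF u] by (simp add: vertex_weight_def)
  finally show "(\<integral>\<^sup>+ v. ennreal (?f v) \<partial>count_space UNIV) = 1" by simp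
qed

section \<open>Measurability of the walk\<close>

lemma sets_step_law: "sets (step_law u) = sets (count_space UNIV \<Otimes>\<^sub>M borel)"
  by (intro sets_pair_measure_cong) auto

lemma measurable_coord:
  assumes "z \<in> verts G" "\<phi> \<in> measurable (count_space UNIV \<Otimes>\<^sub>M borel) N"
  shows "(\<lambda>\<omega>. \<phi> (\<omega> (n, z))) \<in> measurable \<Omega> N"
proof -
  have "(\<lambda>\<omega>. \<omega> (n, z)) \<in> measurable \<Omega> (step_law (snd (n, z)))"
    unfolding walk_space_eq by (rule measurable_component_singleton) (use assms in auto)
  moreover have "\<phi> \<in> measurable (step_law z) N"
    using assms(2) measurable_cong_sets[OF sets_step_law refl] by blast
  ultimately show ?thesis by (auto intro: measurable_compose)
qed

text \<open>Outside \<open>verts G\<close> the coordinates of a point of the product space are \<open>undefined\<close>, so that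
  they can be evaluated at a random index although the type of vertices is uncountable.\<close>

lemma measurable_random_coord:
  assumes X: "X \<in> measurable \<Omega> (count_space UNIV)" and u: "u \<in> verts G"
    and \<phi>: "\<phi> \<in> measurable (count_space UNIV \<Otimes>\<^sub>M borel) N"
  shows "(\<lambda>\<omega>. \<phi> (\<omega> (n, X \<omega>))) \<in> measurable \<Omega> N"
proof -
  define Y where "Y = (\<lambda>\<omega>. if X \<omega> \<in> verts G then X \<omega> else u)"
  have "(\<lambda>z. if z \<in> verts G then z else u) \<in> measurable (count_space UNIV) (count_space (verts G))"
    using u by auto
  from measurable_compose[OF X this] have Y: "Y \<in> measurable \<Omega> (count_space (verts G))"
    by (simp add: Y_def)
  have "(\<lambda>\<omega>. \<phi> (\<omega> (n, Y \<omega>))) \<in> measurable \<Omega> N"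
    by (rule measurable_compose_countable'[OF _ Y countable_verts]) (rule measurable_coord[OF _ \<phi>])
  moreover have "(\<lambda>\<omega>. \<phi> undefined) \<in> measurable \<Omega> N"
    using measurable_space[OF \<phi>] by (intro measurable_const) (auto simp: space_pair_measure)
  moreover have "{\<omega> \<in> space \<Omega>. X \<omega> \<in> verts G} \<in> sets \<Omega>"
    using measurable_sets[OF X, of "verts G"] by (simp add: vimage_def Int_def conj_commute)
  ultimately have "(\<lambda>\<omega>. if X \<omega> \<in> verts G then \<phi> (\<omega> (n, Y \<omega>)) else \<phi> undefined) \<in> measurable \<Omega> N"
    by (intro measurable_If) auto
  moreover have "\<phi> (\<omega> (n, X \<omega>)) = (if X \<omega> \<in> verts G then \<phi> (\<omega> (n, Y \<omega>)) else \<phi> undefined)"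
    if "\<omega> \<in> space \<Omega>" for \<omega>
    using that by (auto simp: Y_def walk_space_eq space_PiM PiE_def extensional_def)
  ultimately show ?thesis by (subst measurable_cong) auto
qed

lemma measurable_jump_chain:
  assumes "u \<in> verts G"
  shows "(\<lambda>\<omega>. jump_chain u \<omega> n) \<in> measurable \<Omega> (count_space UNIV)"
proof (induction n)
  case (Suc n)
  show ?case unfolding jump_chain.simps
    by (rule measurable_random_coord[OF Suc assms]) simp
qed simp

lemma measurable_holding_time:
  assumes "u \<in> verts G"
  shows "(\<lambda>\<omega>. holding_time u \<omega> n) \<in> borel_measurable \<Omega>"
  unfolding holding_time_def
  by (rule measurable_random_coord[OF measurable_jump_chain[OF assms] assms]) simp

lemma walk_event_sets:
  assumes "u \<in> verts G"
  shows "{\<omega> \<in> space \<Omega>. walk u t \<omega> = v} \<in> sets \<Omega>"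
proof -
  note [measurable] = measurable_holding_time[OF assms]
  have "(\<lambda>\<omega>. LEAST n. t < (\<Sum>i\<le>n. holding_time u \<omega> i)) \<in> measurable \<Omega> (count_space UNIV)"
    by measurable
  then have "(\<lambda>\<omega>. walk u t \<omega>) \<in> measurable \<Omega> (count_space UNIV)"
    unfolding walk_def by (intro measurable_compose_countable[OF measurable_jump_chain[OF assms]])
  from measurable_sets[OF this, of "{v}"] show ?thesis
    by (simp add: vimage_def Int_def conj_commute)
qed

lemma AE_step_edge:
  assumes "z \<in> verts G" shows "AE x in step_law z. {z, fst x} \<in> edges G"
proof -
  interpret prob_space "exp_law z" using prob_exp_law assms by simp
  have "AE x in distr (step_law z) (measure_pmf (jump_pmf G z)) fst. {z, x} \<in> edges G"
    unfolding distr_pair_fst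
    by (auto simp: AE_measure_pmf_iff set_pmf_iff pmf_jump[OF assms] split: if_splits)
  then show ?thesis by (intro AE_distrD[where f = fst]) auto
qed

text \<open>The vertex occupied after \<open>n\<close> jumps is random, so one null set has to serve
  all coordinates; there are countably many.\<close>

lemma AE_edges: "AE \<omega> in \<Omega>. \<forall>n. \<forall>z\<in>verts G. {z, fst (\<omega> (n, z))} \<in> edges G"
proof -
  have "AE \<omega> in \<Omega>. {z, fst (\<omega> (n, z))} \<in> edges G" if z: "z \<in> verts G" for n z
    unfolding walk_space_eq
  proof (rule AE_PiM_component[where P = "\<lambda>x. {z, fst x} \<in> edges G" and i = "(n, z)"])
    show "AE x in step_law (snd (n, z)). {z, fst x} \<in> edges G"
      using AE_step_edge[OF z] by (simp only: snd_conv)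
  qed (use z prob_step_law in auto)
  then show ?thesis
    by (simp add: AE_all_countable AE_ball_countable countable_verts)
qed

text \<open>The time index makes the map from \<open>i\<close> to \<open>(i, w i)\<close> injective,
  so the coordinates along a fixed path are independent even if the path revisits a vertex.\<close>

lemma nn_integral_path:
  assumes w: "\<And>i. w i \<in> verts G" and g: "\<And>i. g i \<in> borel_measurable (step_law (w i))"
  shows "(\<integral>\<^sup>+ \<omega>. (\<Prod>i<d. g i (\<omega> (i, w i))) \<partial>\<Omega>) = (\<Prod>i<d. \<integral>\<^sup>+ x. g i x \<partial>step_law (w i))"
proof -
  interpret S: product_sigma_finite "\<lambda>i. step_law (w i)"
    using prob_step_law[OF w] by (simp add: product_sigma_finite_def prob_space_imp_sigma_finite)
  let ?f = "\<lambda>i::nat. (i, w i)"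
  let ?r = "\<lambda>\<omega>. \<lambda>i\<in>{..<d}. \<omega> (?f i)"
  let ?P = "PiM {..<d} (\<lambda>i. step_law (w i))"
  have D: "distr \<Omega> ?P ?r = ?P"
    using distr_PiM_reindex[of "UNIV \<times> verts G" "\<lambda>i. step_law (snd i)" ?f "{..<d}"] w
    by (auto simp: walk_space_eq prob_step_law inj_on_def)
  have c: "(\<lambda>\<omega>. \<omega> (i, w i)) \<in> measurable \<Omega> (step_law (w i))" for i
  proof -
    have "(\<lambda>\<omega>. \<omega> (i, w i)) \<in> measurable \<Omega> (step_law (snd (i, w i)))"
      unfolding walk_space_eq by (rule measurable_component_singleton) (use w in auto)
    then show ?thesis by simp
  qed
  have r: "?r \<in> measurable \<Omega> ?P" by (rule measurable_restrict) (rule c)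
  have "(\<Prod>i<d. \<integral>\<^sup>+ x. g i x \<partial>step_law (w i)) = (\<integral>\<^sup>+ y. (\<Prod>i<d. g i (y i)) \<partial>?P)"
    by (rule S.product_nn_integral_prod[symmetric]) (auto intro: g)
  also have "\<dots> = (\<integral>\<^sup>+ y. (\<Prod>i<d. g i (y i)) \<partial>distr \<Omega> ?P ?r)" unfolding D ..
  also have "\<dots> = (\<integral>\<^sup>+ \<omega>. (\<Prod>i<d. g i (?r \<omega> i)) \<partial>\<Omega>)"
  proof -
    have "(\<lambda>y. g i (y i)) \<in> borel_measurable ?P" if i: "i < d" for i
    proof -
      have "(\<lambda>y. y i) \<in> measurable ?P (step_law (w i))"
        using i measurable_component_singleton[of i "{..<d}" "\<lambda>i. step_law (w i)"] by simp
      then show ?thesis by (rule measurable_compose[OF _ g])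
    qed
    then have "(\<lambda>y. \<Prod>i<d. g i (y i)) \<in> borel_measurable ?P" by (intro borel_measurable_prod_ennreal) auto
    then have "(\<lambda>y. \<Prod>i<d. g i (y i)) \<in> borel_measurable (distr \<Omega> ?P ?r)" by simp
    from nn_integral_distr[OF r this] show ?thesis .
  qed
  finally show ?thesis by simp
qed

lemma nn_integral_step_snd:
  assumes "z \<in> verts G" "f \<in> borel_measurable borel"
  shows "(\<integral>\<^sup>+ x. f (snd x) \<partial>step_law z) = (\<integral>\<^sup>+ s. f s \<partial>exp_law z)"
proof -
  interpret prob_space "exp_law z" using prob_exp_law assms by simp
  have m: "(\<lambda>x. f (snd x)) \<in> borel_measurable (step_law z)"
    using assms(2) by (intro measurable_compose[OF measurable_snd]) simp
  show ?thesis
    using nn_integral_fst[OF m] by (simp add: measure_pmf.emeasure_space_1)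
qed

text \<open>The exponent \<open>d / t\<close> makes the Chernoff bound of the same order as the volume
  \<open>t ^ d / fact d\<close> of the simplex, up to a factor exponential in \<open>d\<close>.\<close>

lemma path_holding_times_le:
  assumes w: "\<And>i. w i \<in> verts G" and t: "0 < t" and d: "0 < d"
  shows "emeasure \<Omega> {\<omega> \<in> space \<Omega>. (\<Sum>i<d. snd (\<omega> (i, w i))) \<le> t} \<le> ennreal ((exp 1 * b * t / d) ^ d)"
proof -
  define \<theta> where "\<theta> = d / t"
  have \<theta>: "0 < \<theta>" using t d by (simp add: \<theta>_def)
  let ?g = "\<lambda>x :: complex \<times> real. ennreal (exp (- \<theta> * snd x))"
  have g: "?g \<in> borel_measurable (count_space UNIV \<Otimes>\<^sub>M borel)" by measurable
  have g': "?g \<in> borel_measurable (step_law z)" for z by measurable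
  have gm: "(\<lambda>\<omega>. ?g (\<omega> (i, w i))) \<in> borel_measurable \<Omega>" for i
    by (rule measurable_coord[OF w g])
  have sm: "(\<lambda>\<omega>. snd (\<omega> (i, w i))) \<in> borel_measurable \<Omega>" for i
    by (rule measurable_coord[OF w]) simp
  have S: "{\<omega> \<in> space \<Omega>. (\<Sum>i<d. snd (\<omega> (i, w i))) \<le> t} \<in> sets \<Omega>"
    using sm by measurable
  have "emeasure \<Omega> {\<omega> \<in> space \<Omega>. (\<Sum>i<d. snd (\<omega> (i, w i))) \<le> t}
      = (\<integral>\<^sup>+ \<omega>. indicator {\<omega> \<in> space \<Omega>. (\<Sum>i<d. snd (\<omega> (i, w i))) \<le> t} \<omega> \<partial>\<Omega>)"
    using S by simp
  \<comment> \<open>Chernoff's inequality: since \<open>\<theta> * t = d\<close>, the exponent of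
    the integrand is nonnegative on the event.\<close>
  also have "\<dots> \<le> (\<integral>\<^sup>+ \<omega>. ennreal (exp d) * (\<Prod>i<d. ?g (\<omega> (i, w i))) \<partial>\<Omega>)"
  proof (rule nn_integral_mono)
    fix \<omega>
    have e: "ennreal (exp d) * (\<Prod>i<d. ?g (\<omega> (i, w i))) = ennreal (exp (d - \<theta> * (\<Sum>i<d. snd (\<omega> (i, w i)))))"
      by (simp add: prod_ennreal exp_sum[symmetric] ennreal_mult[symmetric] exp_add[symmetric] 
        sum_distrib_left sum_negf)
    have "1 \<le> exp (d - \<theta> * (\<Sum>i<d. snd (\<omega> (i, w i))))" if "(\<Sum>i<d. snd (\<omega> (i, w i))) \<le> t"
    proof -
      have "\<theta> * (\<Sum>i<d. snd (\<omega> (i, w i))) \<le> \<theta> * t" using that \<theta> by (intro mult_left_mono) auto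
      then show ?thesis using t by (simp add: \<theta>_def)
    qed
    then show "indicator {\<omega> \<in> space \<Omega>. (\<Sum>i<d. snd (\<omega> (i, w i))) \<le> t} \<omega> \<le> ennreal (exp d) * (\<Prod>i<d. ?g (\<omega> (i, w i)))"
      unfolding e by (auto split: split_indicator)
  qed
  also have "\<dots> = ennreal (exp d) * (\<integral>\<^sup>+ \<omega>. (\<Prod>i<d. ?g (\<omega> (i, w i))) \<partial>\<Omega>)"
    using gm by (intro nn_integral_cmult borel_measurable_prod_ennreal) auto
  also have "\<dots> = ennreal (exp d) * (\<Prod>i<d. \<integral>\<^sup>+ x. ?g x \<partial>step_law (w i))"
    by (subst nn_integral_path[OF w g']) simp
  also have "\<dots> = ennreal (exp d) * (\<Prod>i<d. ennreal (jump_rate G (w i) / (jump_rate G (w i) + \<theta>)))"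
    using nn_integral_step_snd[OF w, of "\<lambda>s. ennreal (exp (- \<theta> * s))"]
      nn_integral_exponential_laplace[OF rate_pos[OF w] \<theta>] by simp
  also have "\<dots> \<le> ennreal (exp d) * (\<Prod>i<d. ennreal (b / \<theta>))"
  proof -
    have "jump_rate G (w i) / (jump_rate G (w i) + \<theta>) \<le> b / \<theta>" for i
      using rate_le[OF w, of i] rate_pos[OF w, of i] \<theta> by (intro frac_le) auto
    then have "(\<Prod>i<d. ennreal (jump_rate G (w i) / (jump_rate G (w i) + \<theta>))) \<le> (\<Prod>i<d. ennreal (b / \<theta>))"
      by (intro prod_mono_ennreal ennreal_leI)
    then show ?thesis by (rule mult_left_mono) simp
  qed
  also have "\<dots> = ennreal ((exp 1 * b * t / d) ^ d)"
  proof -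
    have "0 < b" using rate_pos[OF w] rate_le[OF w] by (meson less_le_trans)
    then have "ennreal (exp d) * (\<Prod>i<d. ennreal (b / \<theta>)) = ennreal (exp d * (b / \<theta>) ^ d)"
      using \<theta> by (simp add: ennreal_power ennreal_mult)
    also have "exp (real d) * (b / \<theta>) ^ d = (exp 1 * b * t / d) ^ d"
    proof -
      have "exp (real d) = exp 1 ^ d" by (simp flip: exp_of_nat_mult)
      then show ?thesis by (simp add: \<theta>_def mult.assoc power_mult_distrib[symmetric])
    qed
    finally show ?thesis .
  qed
  finally show ?thesis .
qed

section \<open>Counting paths and the upper bound\<close>

text \<open>A path is stored as a function with value \<open>u\<close> beyond index
  \<open>n\<close>. Equal paths are then equal functions, and the set is finite.\<close>

primrec paths :: "complex \<Rightarrow> nat \<Rightarrow> (nat \<Rightarrow> complex) set" where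
  "paths u 0 = {\<lambda>_. u}"
| "paths u (Suc n) = (\<Union>w\<in>paths u n. (\<lambda>v. w(Suc n := v)) ` {v. {w n, v} \<in> edges G})"

lemma paths_verts: "u \<in> verts G \<Longrightarrow> w \<in> paths u n \<Longrightarrow> w i \<in> verts G"
  by (induction n arbitrary: w) (auto intro: edge_verts)

lemma finite_card_paths:
  assumes "u \<in> verts G" shows "finite (paths u n) \<and> card (paths u n) \<le> K ^ n"
proof (induction n)
  case (Suc n)
  let ?N = "\<lambda>w. (\<lambda>v. w(Suc n := v)) ` {v. {w n, v} \<in> edges G}"
  have N: "finite (?N w)" "card (?N w) \<le> K" if "w \<in> paths u n" for w
  proof -
    have v: "w n \<in> verts G" using paths_verts assms that by blast
    show "finite (?N w)" using finite_nbrs[OF v] by simp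
    have "card (?N w) \<le> card {v. {w n, v} \<in> edges G}" by (rule card_image_le[OF finite_nbrs[OF v]])
    then show "card (?N w) \<le> K" using card_nbrs[OF v] by linarith
  qed
  have "card (paths u (Suc n)) \<le> (\<Sum>w\<in>paths u n. card (?N w))"
    using Suc by (simp add: card_UN_le)
  then have "real (card (paths u (Suc n))) \<le> real (\<Sum>w\<in>paths u n. card (?N w))"
    by (rule of_nat_mono)
  also have "\<dots> = (\<Sum>w\<in>paths u n. real (card (?N w)))" by simp
  also have "\<dots> \<le> (\<Sum>w\<in>paths u n. K)" using N by (intro sum_mono) auto
  also have "\<dots> = card (paths u n) * K" by simp
  also have "\<dots> \<le> K ^ n * K" using Suc K_nonneg by (intro mult_right_mono) auto
  finally have "card (paths u (Suc n)) \<le> K ^ Suc n" by (simp only: power_Suc2)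
  moreover have "finite (paths u (Suc n))" unfolding paths.simps using Suc N by blast
  ultimately show ?case by blast
qed simp

lemma jump_chain_in_paths:
  assumes "\<And>n. {jump_chain u \<omega> n, jump_chain u \<omega> (Suc n)} \<in> edges G"
  shows "(\<lambda>i. if i \<le> n then jump_chain u \<omega> i else u) \<in> paths u n"
proof (induction n)
  case (Suc n)
  have "(\<lambda>i. if i \<le> Suc n then jump_chain u \<omega> i else u)
      = (\<lambda>i. if i \<le> n then jump_chain u \<omega> i else u)(Suc n := jump_chain u \<omega> (Suc n))"
    by (auto simp: fun_eq_iff)
  then show ?case using Suc assms[of n] by (auto intro!: bexI[OF _ Suc] imageI)
qed (auto simp: fun_eq_iff)

text \<open>A union bound over the at most \<open>K ^ d\<close> initial segments of length
  \<open>d\<close>: on the event, the holding times along the segment that the walk follows add up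
  to at most \<open>t\<close>.\<close>

lemma walk_prob_le:
  assumes u: "u \<in> verts G" and t: "0 < t" and dist_le: "\<And>w n. w 0 = u \<Longrightarrow> w n = v \<Longrightarrow> (\<And>i. i < n \<Longrightarrow> {w i, w (Suc i)} \<in> edges G) \<Longrightarrow> d \<le> n"
  shows "measure \<Omega> {\<omega> \<in> space \<Omega>. walk u t \<omega> = v} \<le> (K * exp 1 * b * t / d) ^ d"
proof (cases "d = 0")
  case True
  then show ?thesis using prob_space.prob_le_1[OF prob_walk_space] by simp
next
  case False
  interpret prob_space \<Omega> by (rule prob_walk_space)
  let ?B = "\<lambda>w. {\<omega> \<in> space \<Omega>. (\<Sum>i<d. snd (\<omega> (i, w i))) \<le> t}"
  have wv: "w i \<in> verts G" if "w \<in> paths u d" for w i using paths_verts u that by blast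
  have Bs: "?B w \<in> sets \<Omega>" if "w \<in> paths u d" for w
  proof -
    have "(\<lambda>\<omega>. snd (\<omega> (i, w i))) \<in> borel_measurable \<Omega>" for i
      by (rule measurable_coord[OF wv[OF that]]) simp
    then show ?thesis by measurable
  qed
  have bpos: "0 < b" using rate_pos[OF u] rate_le[OF u] by linarith
  have fin: "finite (paths u d)" "card (paths u d) \<le> K ^ d" using finite_card_paths u by auto
  have "AE \<omega> in \<Omega>. \<omega> \<in> {\<omega> \<in> space \<Omega>. walk u t \<omega> = v} \<longrightarrow> \<omega> \<in> (\<Union>w\<in>paths u d. ?B w)"
  proof (rule eventually_mono[OF AE_edges], rule impI)
    fix \<omega> assume good: "\<forall>n. \<forall>z\<in>verts G. {z, fst (\<omega> (n, z))} \<in> edges G"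
      and \<omega>: "\<omega> \<in> {\<omega> \<in> space \<Omega>. walk u t \<omega> = v}"
    have cv: "jump_chain u \<omega> n \<in> verts G" for n
      by (induction n) (use u good in \<open>auto intro: edge_verts\<close>)
    then have ce: "{jump_chain u \<omega> n, jump_chain u \<omega> (Suc n)} \<in> edges G" for n using good by simp
    define w where "w = (\<lambda>i. if i \<le> d then jump_chain u \<omega> i else u)"
    have w: "w \<in> paths u d" unfolding w_def by (rule jump_chain_in_paths[OF ce])
    \<comment> \<open>Otherwise the least index in the definition of \<open>walk\<close> is at most
      \<open>d - 1\<close>, although the chain is at \<open>v\<close> at that index, which takes at
      least \<open>d\<close> jumps.\<close>
    have "(\<Sum>i<d. holding_time u \<omega> i) \<le> t"
    proof (rule ccontr)
      assume "\<not> ?thesis"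
      then have "t < (\<Sum>i\<le>d - 1. holding_time u \<omega> i)" using False by (simp add: lessThan_Suc_atMost[symmetric])
      then have "(LEAST n. t < (\<Sum>i\<le>n. holding_time u \<omega> i)) \<le> d - 1" by (rule Least_le)
      moreover have "d \<le> (LEAST n. t < (\<Sum>i\<le>n. holding_time u \<omega> i))"
        using \<omega> ce by (intro dist_le[of "jump_chain u \<omega>"]) (auto simp: walk_def)
      ultimately show False using False by simp
    qed
    moreover have "(\<Sum>i<d. holding_time u \<omega> i) = (\<Sum>i<d. snd (\<omega> (i, w i)))"
      by (intro sum.cong) (auto simp: holding_time_def w_def)
    ultimately show "\<omega> \<in> (\<Union>w\<in>paths u d. ?B w)" using w \<omega> by auto
  qed
  then have "emeasure \<Omega> {\<omega> \<in> space \<Omega>. walk u t \<omega> = v} \<le> emeasure \<Omega> (\<Union>w\<in>paths u d. ?B w)"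
    using Bs fin by (intro emeasure_mono_AE sets.finite_UN) auto
  also have "\<dots> \<le> (\<Sum>w\<in>paths u d. emeasure \<Omega> (?B w))"
    using Bs fin by (intro emeasure_subadditive_finite) auto
  also have "\<dots> \<le> (\<Sum>w\<in>paths u d. ennreal ((exp 1 * b * t / d) ^ d))"
    using path_holding_times_le[OF wv t] False by (intro sum_mono) auto
  also have "\<dots> = ennreal (card (paths u d) * (exp 1 * b * t / d) ^ d)"
    using bpos t by (simp add: ennreal_mult ennreal_of_nat_eq_real_of_nat)
  also have "\<dots> \<le> ennreal (K ^ d * (exp 1 * b * t / d) ^ d)"
    using fin bpos t by (intro ennreal_leI mult_right_mono) auto
  also have "K ^ d * (exp 1 * b * t / d) ^ d = (K * exp 1 * b * t / d) ^ d"
    by (simp flip: power_mult_distrib add: mult.assoc)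
  finally show ?thesis
    using bpos t K_nonneg by (simp add: emeasure_eq_measure)
qed

section \<open>The lower bound\<close>

text \<open>A sufficient event: the first \<open>d\<close> jumps follow \<open>w\<close>, each after
  a time in \<open>(0, t / d]\<close>, and the next holding time exceeds \<open>t\<close>, so that
  the walk still sits at \<open>v\<close>. One factor \<open>exp (- b * t)\<close> pays for the
  first \<open>d\<close> waits together, a second one for the last wait.\<close>

lemma walk_prob_ge:
  assumes u: "u \<in> verts G" and t: "0 < t" and w: "w 0 = u" "w d = v" "\<And>i. i < d \<Longrightarrow> {w i, w (Suc i)} \<in> edges G"
  shows "(\<delta> * a * t / d) ^ d * exp (- 2 * b * t - 1) \<le> measure \<Omega> {\<omega> \<in> space \<Omega>. walk u t \<omega> = v}"
proof -
  interpret prob_space \<Omega> by (rule prob_walk_space)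
  \<comment> \<open>Continued constantly after index \<open>d\<close>, the path stays in
    \<open>verts G\<close> at every index, as the product formula requires.\<close>
  define z where "z = (\<lambda>i. w (min i d))"
  have zw: "i \<le> d \<Longrightarrow> z i = w i" for i by (simp add: z_def)
  have wv: "w i \<in> verts G" if "i \<le> d" for i
  proof (cases i)
    case (Suc j)
    then show ?thesis using edge_verts[OF w(3)[of j]] that by simp
  qed (use u w(1) in simp)
  then have zv: "z i \<in> verts G" for i by (simp add: z_def)
  define l where "l = (\<lambda>i. jump_rate G (z i))"
  have l: "0 < l i" "a \<le> l i" "l i \<le> b" for i
    using rate_pos rate_ge rate_le zv by (auto simp: l_def)
  have bpos: "0 < b" using l[of 0] by linarith
  define c where "c = t / d"
  have c: "0 \<le> c" using t by (simp add: c_def)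
  \<comment> \<open>The window for the last wait has the mean holding time \<open>1 / l d\<close> as
    its length; bounding the density by its value at the right end then costs only a factor
    \<open>exp (- 1)\<close>.\<close>
  define A where "A = (\<lambda>i. if i < d then {z (Suc i)} \<times> {0<..c} else UNIV \<times> {t<..t + 1 / l d})"
  have As: "A i \<in> sets (count_space UNIV \<Otimes>\<^sub>M borel)" for i by (auto simp: A_def)
  then have As': "A i \<in> sets (step_law (z i))" for i unfolding sets_step_law .
  let ?E = "{\<omega> \<in> space \<Omega>. \<forall>i\<in>{..<Suc d}. \<omega> (i, z i) \<in> A i}"
  have sub: "?E \<subseteq> {\<omega> \<in> space \<Omega>. walk u t \<omega> = v}"
  proof safe
    fix \<omega> assume \<omega>: "\<forall>i\<in>{..<Suc d}. \<omega> (i, z i) \<in> A i"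
    have step: "fst (\<omega> (i, z i)) = z (Suc i)" "0 < snd (\<omega> (i, z i))" "snd (\<omega> (i, z i)) \<le> c" if "i < d" for i
      using \<omega>[rule_format, of i] that by (auto simp: A_def mem_Times_iff)
    have last: "t < snd (\<omega> (d, z d))" using \<omega>[rule_format, of d] by (auto simp: A_def)
    have ch: "i \<le> d \<Longrightarrow> jump_chain u \<omega> i = z i" for i
      by (induction i) (use w(1) step in \<open>auto simp: z_def\<close>)
    have ht: "i \<le> d \<Longrightarrow> holding_time u \<omega> i = snd (\<omega> (i, z i))" for i
      by (simp add: holding_time_def ch)
    have "(LEAST n. t < (\<Sum>i\<le>n. holding_time u \<omega> i)) = d"
    proof (rule Least_equality)
      have "0 \<le> (\<Sum>i<d. holding_time u \<omega> i)"
        using step ht by (intro sum_nonneg) (auto intro: less_imp_le)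
      moreover have "(\<Sum>i\<le>d. holding_time u \<omega> i) = (\<Sum>i<d. holding_time u \<omega> i) + holding_time u \<omega> d"
        by (simp add: lessThan_Suc_atMost[symmetric])
      ultimately show "t < (\<Sum>i\<le>d. holding_time u \<omega> i)" using last ht[of d] by simp
    next
      fix n assume n: "t < (\<Sum>i\<le>n. holding_time u \<omega> i)"
      show "d \<le> n"
      proof (rule ccontr)
        assume "\<not> d \<le> n"
        then have "(\<Sum>i\<le>n. holding_time u \<omega> i) \<le> (\<Sum>i\<le>n. c)"
          using step ht by (intro sum_mono) auto
        also have "\<dots> = (n + 1) * c" by simp
        also have "\<dots> \<le> d * c" using \<open>\<not> d \<le> n\<close> c by (intro mult_right_mono) auto
        also have "\<dots> = t" using \<open>\<not> d \<le> n\<close> by (simp add: c_def)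
        finally show False using n by simp
      qed
    qed
    then show "walk u t \<omega> = v" using ch[of d] w(2) by (simp add: walk_def z_def)
  qed
  have Es: "?E \<in> sets \<Omega>"
  proof -
    have "{\<omega> \<in> space \<Omega>. \<omega> (i, z i) \<in> A i} \<in> sets \<Omega>" for i
    proof -
      have "(\<lambda>\<omega>. \<omega> (i, z i) \<in> A i) \<in> measurable \<Omega> (count_space UNIV)"
        by (rule measurable_coord[OF zv, where \<phi> = "\<lambda>x. x \<in> A i"]) (use As in \<open>measurable\<close>)
      then show ?thesis by (simp add: pred_def)
    qed
    then show ?thesis by (intro sets.sets_Collect_finite_All) auto
  qed
  have ind: "(indicator (A i) :: _ \<Rightarrow> ennreal) \<in> borel_measurable (step_law (z i))" for i
    using As' by simp
  have "(\<Prod>i<Suc d. emeasure (step_law (z i)) (A i)) = (\<Prod>i<Suc d. \<integral>\<^sup>+ x. indicator (A i) x \<partial>step_law (z i))"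
    using As' by simp
  also have "\<dots> = (\<integral>\<^sup>+ \<omega>. (\<Prod>i<Suc d. indicator (A i) (\<omega> (i, z i))) \<partial>\<Omega>)"
    by (rule nn_integral_path[OF zv ind, symmetric])
  also have "\<dots> = (\<integral>\<^sup>+ \<omega>. indicator ?E \<omega> \<partial>\<Omega>)"
  proof (rule nn_integral_cong)
    fix \<omega> assume "\<omega> \<in> space \<Omega>"
    then show "(\<Prod>i<Suc d. indicator (A i) (\<omega> (i, z i))) = (indicator ?E \<omega> :: ennreal)"
    proof (cases "\<omega> \<in> ?E")
      case True then show ?thesis by (simp add: prod.neutral del: prod.lessThan_Suc)
    next
      case False
      then obtain i where "i \<in> {..<Suc d}" "\<omega> (i, z i) \<notin> A i" using \<open>\<omega> \<in> space \<Omega>\<close> by blast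
      then have "(\<Prod>i<Suc d. indicator (A i) (\<omega> (i, z i))) = (0 :: ennreal)"
        by (intro prod_zero) (auto intro!: bexI[of _ i])
      then show ?thesis using False by simp
    qed
  qed
  also have "\<dots> = emeasure \<Omega> ?E" using Es by simp
  also have "\<dots> \<le> emeasure \<Omega> {\<omega> \<in> space \<Omega>. walk u t \<omega> = v}"
    by (rule emeasure_mono[OF sub walk_event_sets[OF u]])
  finally have 1: "(\<Prod>i<d. emeasure (step_law (z i)) (A i)) * emeasure (step_law (z d)) (A d)
      \<le> emeasure \<Omega> {\<omega> \<in> space \<Omega>. walk u t \<omega> = v}" by simp
  have times: "emeasure (step_law (z i)) (S \<times> T) = emeasure (measure_pmf (jump_pmf G (z i))) S * emeasure (exp_law (z i)) T"
    if "T \<in> sets borel" for i S T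
  proof -
    interpret E: prob_space "exp_law (z i)" using prob_exp_law zv by simp
    show ?thesis using that by (intro E.emeasure_pair_measure_Times) auto
  qed
  have lo: "ennreal (\<delta> * (c * a * exp (- c * b))) \<le> emeasure (step_law (z i)) (A i)" if i: "i < d" for i
  proof -
    have e: "{z i, z (Suc i)} \<in> edges G" using w(3)[OF i] i by (simp add: z_def)
    have "ennreal \<delta> \<le> emeasure (measure_pmf (jump_pmf G (z i))) {z (Suc i)}"
      using jump_prob[OF e] e by (simp add: emeasure_pmf_single pmf_jump[OF zv] ennreal_leI)
    moreover have "ennreal (c * a * exp (- c * b)) \<le> emeasure (exp_law (z i)) {0<..c}"
    proof -
      have "c * a * exp (- c * b) \<le> (c - 0) * l i * exp (- c * l i)"
        using c l[of i] a_pos by (intro mult_mono) (auto intro: mult_left_mono)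
      then show ?thesis
        using emeasure_exponential_ge[OF l(1), of 0 c i] c unfolding l_def
        by (meson ennreal_leI order.trans order.refl)
    qed
    ultimately have "ennreal \<delta> * ennreal (c * a * exp (- c * b)) \<le> emeasure (step_law (z i)) (A i)"
      unfolding A_def using i by (simp add: times mult_mono)
    then show ?thesis using \<delta>_pos c a_pos by (simp add: ennreal_mult)
  qed
  have hi: "ennreal (exp (- b * t - 1)) \<le> emeasure (step_law (z d)) (A d)"
  proof -
    have "exp (- b * t - 1) \<le> (t + 1 / l d - t) * l d * exp (- (t + 1 / l d) * l d)"
      using l[of d] t by (simp add: algebra_simps)
    then have "ennreal (exp (- b * t - 1)) \<le> emeasure (exp_law (z d)) {t<..t + 1 / l d}"
      using emeasure_exponential_ge[OF l(1)[of d], of t "t + 1 / l d"] t l(1)[of d] unfolding l_def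
      by (meson ennreal_leI order.trans less_imp_le le_add_same_cancel1 zero_le_divide_1_iff)
    then show ?thesis by (simp add: A_def times measure_pmf.emeasure_space_1[simplified])
  qed
  have \<rho>: "0 \<le> \<delta> * (c * a * exp (- c * b))" using \<delta>_pos c a_pos by simp
  have "ennreal ((\<delta> * (c * a * exp (- c * b))) ^ d * exp (- b * t - 1))
      = (\<Prod>i<d. ennreal (\<delta> * (c * a * exp (- c * b)))) * ennreal (exp (- b * t - 1))"
    unfolding prod_constant card_lessThan ennreal_power[OF \<rho>]
    by (rule ennreal_mult) (use \<rho> in auto)
  also have "\<dots> \<le> (\<Prod>i<d. emeasure (step_law (z i)) (A i)) * emeasure (step_law (z d)) (A d)"
    using lo hi by (intro mult_mono prod_mono_ennreal) auto
  also note 1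
  finally have 2: "(\<delta> * (c * a * exp (- c * b))) ^ d * exp (- b * t - 1)
      \<le> measure \<Omega> {\<omega> \<in> space \<Omega>. walk u t \<omega> = v}"
    by (simp add: emeasure_eq_measure)
  \<comment> \<open>For \<open>d > 0\<close> this is an equality, as \<open>d * c = t\<close>; for
    \<open>d = 0\<close> the power is 1.\<close>
  have "exp (- c * b) ^ d \<ge> exp (- b * t)"
    using bpos t by (cases "d = 0") (simp_all add: c_def flip: exp_of_nat_mult)
  then have "(\<delta> * c * a) ^ d * exp (- b * t) * exp (- b * t - 1)
      \<le> (\<delta> * c * a) ^ d * exp (- c * b) ^ d * exp (- b * t - 1)"
    using \<delta>_pos c a_pos by (intro mult_right_mono mult_left_mono) auto
  also have "\<dots> = (\<delta> * (c * a * exp (- c * b))) ^ d * exp (- b * t - 1)"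
    by (simp add: power_mult_distrib mult_ac)
  also note 2
  also have "(\<delta> * c * a) ^ d * exp (- b * t) * exp (- b * t - 1) = (\<delta> * a * t / d) ^ d * exp (- 2 * b * t - 1)"
    by (simp add: c_def mult_ac flip: exp_add)
  finally show ?thesis .
qed

end

section \<open>Short-time asymptotics\<close>

text \<open>Both directions come from \<open>ln x \<le> x - 1\<close>, applied to \<open>y\<close>
  and to \<open>1 / y\<close>.\<close>

lemma abs_mult_ln_le:
  fixes y :: real assumes "0 \<le> y" "y \<le> Y" shows "\<bar>y * ln y\<bar> \<le> 1 + Y\<^sup>2"
proof (cases "y = 0")
  case False
  then have y: "0 < y" using assms by simp
  have "ln y \<le> y" using ln_le_minus_one[OF y] by simp
  then have "y * ln y \<le> y * y" using y by (intro mult_left_mono) auto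
  also have "\<dots> \<le> Y\<^sup>2" using assms by (simp add: power2_eq_square mult_mono)
  finally have 1: "y * ln y \<le> Y\<^sup>2" .
  have "- ln y \<le> 1 / y" using ln_le_minus_one[of "1 / y"] y by (simp add: ln_div)
  then have "y * (- ln y) \<le> y * (1 / y)" using y by (intro mult_left_mono) auto
  then have "- (y * ln y) \<le> 1" using y by simp
  moreover have "0 \<le> Y\<^sup>2" by simp
  ultimately show ?thesis using 1 by linarith
qed simp

text \<open>For \<open>d > 0\<close> the base equals \<open>c * h powr (\<beta> - 1) / y\<close>.
  The exponent \<open>\<beta> - 2\<close> arises from times of order \<open>h powr \<beta>\<close>
  and rates of order \<open>1 / h\<^sup>2\<close>. For \<open>d = 0\<close> both sides
  vanish.\<close>

lemma ln_power_scaled: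
  fixes c h \<beta> :: real and d :: nat
  assumes "0 < c" "0 < h"
  defines "y \<equiv> h * d"
  shows "h * ln ((c * h powr (\<beta> - 2) / d) ^ d) = y * ((\<beta> - 1) * ln h) + y * ln c - y * ln y"
proof (cases "d = 0")
  case False
  then have d: "0 < real d" by simp
  have 1: "ln (c * h powr (\<beta> - 2) / d) = ln c + (\<beta> - 2) * ln h - ln d"
    using assms(1,2) d by (simp add: ln_div ln_mult ln_powr)
  have 2: "ln y = ln h + ln d" using assms(2) d by (simp add: y_def ln_mult)
  show ?thesis unfolding ln_realpow 1 2 unfolding y_def by (simp add: algebra_simps)
qed (simp add: y_def)

text \<open>The terms with \<open>c\<^sub>1\<close> and \<open>c\<^sub>2\<close> come from the bases
  of the powers, \<open>Y\<^sup>2 + 1\<close> from \<open>y * ln y\<close>, \<open>E + 1\<close>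
  from the exponential factor, and the rest from the logarithm of the area.\<close>

lemma log_heat_kernel_estimate:
  fixes h \<beta> P A c\<^sub>1 c\<^sub>2 E \<alpha> \<gamma> Y :: real and d :: nat
  assumes h: "0 < h" "h < 1" and \<beta>: "1 < \<beta>" and c: "0 < c\<^sub>1" "0 < c\<^sub>2" and E: "0 \<le> E" and \<alpha>: "0 < \<alpha>"
    and lower: "(c\<^sub>1 * h powr (\<beta> - 2) / d) ^ d * exp (- E * h powr (\<beta> - 2) - 1) \<le> P"
    and upper: "P \<le> (c\<^sub>2 * h powr (\<beta> - 2) / d) ^ d"
    and area: "\<alpha> * h\<^sup>2 \<le> A" "A \<le> \<gamma> * h\<^sup>2" and Y: "h * d \<le> Y"
  shows "\<bar>h * ln (P / A) - h * d * ((\<beta> - 1) * ln h)\<bar>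
    \<le> Y * \<bar>ln c\<^sub>1\<bar> + Y * \<bar>ln c\<^sub>2\<bar> + Y\<^sup>2 + E + 2 + \<bar>ln \<alpha>\<bar> + \<bar>ln \<gamma>\<bar> + 2 * h * \<bar>ln h\<bar>"
proof -
  define y where "y = h * d"
  have y: "0 \<le> y" "y \<le> Y" using h Y by (auto simp: y_def)
  have Ypos: "0 \<le> Y" using y by simp
  let ?M = "y * ((\<beta> - 1) * ln h)"
  let ?L = "(c\<^sub>1 * h powr (\<beta> - 2) / d) ^ d" and ?U = "(c\<^sub>2 * h powr (\<beta> - 2) / d) ^ d"
  have L: "0 < ?L" using c h by (cases "d = 0") auto
  have "0 < ?L * exp (- E * h powr (\<beta> - 2) - 1)" using L by simp
  then have P: "0 < P" using lower by linarith
  have A: "0 < A" using area(1) \<alpha> h by (meson less_le_trans mult_pos_pos zero_less_power)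
  have "0 < \<gamma> * h\<^sup>2" using A area by linarith
  then have \<gamma>: "0 < \<gamma>" using h by (simp add: zero_less_mult_iff)
  have lnc: "\<bar>y * ln k\<bar> \<le> Y * \<bar>ln k\<bar>" for k
    using y by (simp add: abs_mult mult_right_mono)
  have yl: "\<bar>y * ln y\<bar> \<le> 1 + Y\<^sup>2" using abs_mult_ln_le y by blast
  have "h * ln P \<le> h * ln ?U" using upper P h by (intro mult_left_mono ln_mono) auto
  also have "\<dots> = ?M + y * ln c\<^sub>2 - y * ln y"
    unfolding y_def by (rule ln_power_scaled[OF c(2) h(1)])
  finally have up: "h * ln P - ?M \<le> Y * \<bar>ln c\<^sub>2\<bar> + (1 + Y\<^sup>2)"
    using lnc[of c\<^sub>2] yl by linarith
  \<comment> \<open>The exponent \<open>E * h powr (\<beta> - 2)\<close> may be large, but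
    multiplied by \<open>h\<close> it stays below \<open>E\<close> because
    \<open>\<beta> > 1\<close>.\<close>
  have "h * h powr (\<beta> - 2) = h powr (\<beta> - 1)"
    using h by (simp add: powr_mult_base)
  also have "\<dots> \<le> 1" using h \<beta> powr_mono2[of "\<beta> - 1" h 1] by simp
  finally have "E * (h * h powr (\<beta> - 2)) \<le> E * 1" using E by (intro mult_left_mono)
  then have e: "- E - 1 \<le> h * (- E * h powr (\<beta> - 2) - 1)"
    using h by (simp add: algebra_simps)
  have "ln (?L * exp (- E * h powr (\<beta> - 2) - 1)) = ln ?L + (- E * h powr (\<beta> - 2) - 1)"
    using L by (subst ln_mult_pos) auto
  then have "h * ln ?L + h * (- E * h powr (\<beta> - 2) - 1) = h * ln (?L * exp (- E * h powr (\<beta> - 2) - 1))"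
    by (simp add: distrib_left)
  also have "\<dots> \<le> h * ln P" using lower L h by (intro mult_left_mono ln_mono) auto
  finally have "h * ln ?L - E - 1 \<le> h * ln P" using e by linarith
  moreover have "h * ln ?L = ?M + y * ln c\<^sub>1 - y * ln y"
    unfolding y_def by (rule ln_power_scaled[OF c(1) h(1)])
  ultimately have lo: "- (Y * \<bar>ln c\<^sub>1\<bar> + (1 + Y\<^sup>2) + E + 1) \<le> h * ln P - ?M"
    using lnc[of c\<^sub>1] yl by linarith
  have "ln A \<le> ln (\<gamma> * h\<^sup>2)" "ln (\<alpha> * h\<^sup>2) \<le> ln A"
    using area A \<alpha> h by (auto intro!: ln_mono)
  moreover have "ln (\<gamma> * h\<^sup>2) = ln \<gamma> + 2 * ln h" "ln (\<alpha> * h\<^sup>2) = ln \<alpha> + 2 * ln h"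
    using \<alpha> \<gamma> h by (simp_all add: ln_mult_pos ln_realpow)
  ultimately have "\<bar>ln A\<bar> \<le> \<bar>ln \<alpha>\<bar> + \<bar>ln \<gamma>\<bar> + 2 * \<bar>ln h\<bar>" by linarith
  then have "h * \<bar>ln A\<bar> \<le> h * (\<bar>ln \<alpha>\<bar> + \<bar>ln \<gamma>\<bar> + 2 * \<bar>ln h\<bar>)" using h by (intro mult_left_mono) auto
  also have "\<dots> \<le> \<bar>ln \<alpha>\<bar> + \<bar>ln \<gamma>\<bar> + 2 * h * \<bar>ln h\<bar>"
    using h mult_right_mono[of h 1 "\<bar>ln \<alpha>\<bar> + \<bar>ln \<gamma>\<bar>"] by (simp add: algebra_simps)
  finally have hA: "\<bar>h * ln A\<bar> \<le> \<bar>ln \<alpha>\<bar> + \<bar>ln \<gamma>\<bar> + 2 * h * \<bar>ln h\<bar>" using h by (simp add: abs_mult)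
  have "h * ln (P / A) = h * ln P - h * ln A" using P A by (simp add: ln_div right_diff_distrib)
  moreover have "0 \<le> Y * \<bar>ln c\<^sub>1\<bar>" "0 \<le> Y * \<bar>ln c\<^sub>2\<bar>" using Ypos by auto
  ultimately show ?thesis using up lo hA E unfolding y_def[symmetric] by linarith
qed

context isoradial
begin

lemma countable_verts: "countable (verts G)"
proof -
  have "verts G = (\<Union>n::nat. verts G \<inter> ball 0 n)"
    using reals_Archimedean2 by (auto simp: set_eq_iff)
  moreover have "countable (\<Union>n::nat. verts G \<inter> ball 0 n)"
    by (intro countable_UN) (auto intro!: countable_finite finite_verts_Int)
  ultimately show ?thesis by simp
qed

lemma packing_ge_1: "0 \<le> \<rho> \<Longrightarrow> 1 \<le> packing \<rho>"
  using cp_pos by (simp add: packing_def one_le_power)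

abbreviation "rate_lower \<equiv> c\<^sub>d / (2 * pi)"
abbreviation "rate_upper \<equiv> 2 * packing 1 / (pi * c\<^sub>p ^ 3)"
abbreviation "min_prob \<equiv> c\<^sub>d * c\<^sub>p / packing 1"

lemma walk_bounds: "walk_bounds G (rate_lower / h\<^sup>2) (rate_upper / h\<^sup>2) min_prob (packing 1)"
proof
  show "countable (verts G)" by (rule countable_verts)
  show "0 < rate_lower / h\<^sup>2" "0 < min_prob" "0 \<le> packing 1"
    using cd_pos cp_pos h_pos packing_ge_1[of 1] packing_nonneg by auto
next
  fix u v assume uv: "adj u v"
  show "v \<in> verts G" using adjD uv by blast
  show "0 \<le> edge_weight G u v" using edge_weight_bounds(1)[OF uv] cd_pos by linarith
  show "min_prob \<le> edge_weight G u v / vertex_weight G u" by (rule jump_prob_ge[OF uv])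
next
  fix u assume u: "u \<in> verts G"
  show "finite {v. adj u v}" by (rule finite_neighbours)
  show "card {v. adj u v} \<le> packing 1" by (rule card_neighbours_le[OF u])
  show "0 < vertex_weight G u" using vertex_weight_bounds(1)[OF u] cd_pos by linarith
  show "rate_lower / h\<^sup>2 \<le> jump_rate G u" "jump_rate G u \<le> rate_upper / h\<^sup>2"
    by (rule jump_rate_bounds[OF u])+
qed

lemma scaled_graph_dist_le:
  assumes "u \<in> verts G" "v \<in> verts G"
  shows "h * graph_dist G u v \<le> (dist u v + 3 * h) * packing 2 * packing 1"
proof -
  obtain n and w :: "nat \<Rightarrow> complex" where w: "w 0 = u" "w n = v" "\<And>i. i < n \<Longrightarrow> adj (w i) (w (Suc i))"
    "n \<le> (dist u v / h + 3) * packing 2 * packing 1"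
    using graph_dist_bound[OF assms] by metis
  have "real (graph_dist G u v) \<le> (dist u v / h + 3) * packing 2 * packing 1"
    using graph_dist_le[OF w(1-3)] w(4) by linarith
  then have "h * graph_dist G u v \<le> h * ((dist u v / h + 3) * packing 2 * packing 1)"
    using h_pos by (intro mult_left_mono) auto
  also have "\<dots> = (dist u v + 3 * h) * packing 2 * packing 1" using h_pos by (simp add: field_simps)
  finally show ?thesis .
qed

text \<open>Apart from \<open>2 * h * \<bar>ln h\<bar>\<close> the bound involves only
  \<open>c\<^sub>p\<close>, \<open>c\<^sub>d\<close>, \<open>t\<close> and \<open>Y\<close>, so it
  is uniform in \<open>h\<close> once \<open>Y\<close> is.\<close>

lemma heat_kernel_estimate:
  assumes u: "u \<in> verts G" and v: "v \<in> verts G" and h1: "h < 1" and \<beta>: "1 < \<beta>" and t: "0 < t"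
    and Y: "h * graph_dist G u v \<le> Y"
  shows "\<bar>h * ln (heat_kernel G (h powr \<beta> * t) u v) - h * graph_dist G u v * ((\<beta> - 1) * ln h)\<bar>
    \<le> Y * \<bar>ln (min_prob * rate_lower * t)\<bar> + Y * \<bar>ln (packing 1 * exp 1 * rate_upper * t)\<bar> + Y\<^sup>2
      + 2 * rate_upper * t + 2 + \<bar>ln (pi * (c\<^sub>p / 2)\<^sup>2)\<bar> + \<bar>ln pi\<bar> + 2 * h * \<bar>ln h\<bar>"
  unfolding heat_kernel_def
proof (rule log_heat_kernel_estimate[OF h_pos h1 \<beta> _ _ _ _ _ _ _ _ Y])
  interpret W: walk_bounds G "rate_lower / h\<^sup>2" "rate_upper / h\<^sup>2" min_prob "packing 1"
    by (rule walk_bounds)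
  let ?d = "graph_dist G u v" and ?P = "measure (walk_space G) {\<omega> \<in> space (walk_space G). walk u (h powr \<beta> * t) \<omega> = v}"
  have t': "0 < h powr \<beta> * t" using t h_pos by simp
  have scale: "r / h\<^sup>2 * (h powr \<beta> * t) = r * t * h powr (\<beta> - 2)" for r
    using h_pos by (simp add: powr_diff)
  obtain n and w :: "nat \<Rightarrow> complex" where "w 0 = u" "w n = v" "\<And>i. i < n \<Longrightarrow> adj (w i) (w (Suc i))"
    using graph_dist_bound[OF u v] by metis
  then obtain w' where w': "w' 0 = u" "w' ?d = v" "\<And>i. i < ?d \<Longrightarrow> adj (w' i) (w' (Suc i))"
    using graph_dist_attained[of w u n v G] by metis
  have p1: "0 < packing 1" using packing_ge_1[of 1] by simp
  show "0 < min_prob * rate_lower * t" "0 < packing 1 * exp 1 * rate_upper * t"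
    "0 \<le> 2 * rate_upper * t" "0 < pi * (c\<^sub>p / 2)\<^sup>2"
    using p1 cd_pos cp_pos t by auto
  show "(min_prob * rate_lower * t * h powr (\<beta> - 2) / ?d) ^ ?d
      * exp (- (2 * rate_upper * t) * h powr (\<beta> - 2) - 1) \<le> ?P"
  proof -
    have e: "min_prob * (rate_lower / h\<^sup>2) * (h powr \<beta> * t) = min_prob * rate_lower * t * h powr (\<beta> - 2)"
      "- 2 * (rate_upper / h\<^sup>2) * (h powr \<beta> * t) = - (2 * rate_upper * t) * h powr (\<beta> - 2)"
      using scale[of rate_lower] scale[of rate_upper] by (simp_all only: mult.assoc mult_minus_left)
    show ?thesis using W.walk_prob_ge[OF u t' w'] unfolding e .
  qed
  show "?P \<le> (packing 1 * exp 1 * rate_upper * t * h powr (\<beta> - 2) / ?d) ^ ?d"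
  proof -
    have e: "packing 1 * exp 1 * (rate_upper / h\<^sup>2) * (h powr \<beta> * t) = packing 1 * exp 1 * rate_upper * t * h powr (\<beta> - 2)"
      using scale[of rate_upper] by (simp only: mult.assoc)
    show ?thesis using W.walk_prob_le[OF u t', of v ?d] graph_dist_le unfolding e by blast
  qed
  show "pi * (c\<^sub>p / 2)\<^sup>2 * h\<^sup>2 \<le> dual_area G v" "dual_area G v \<le> pi * h\<^sup>2"
    using dual_area_bounds[OF v] by (simp_all add: power_mult_distrib power_divide)
qed

text \<open>A closed face containing \<open>x\<close> lies within \<open>h / 2\<close> of its centre
  and has a vertex, which is therefore within \<open>h\<close> of \<open>x\<close>.\<close>

lemma nearest_vertex_dist:
  assumes "is_arg_min (dist x) (\<lambda>v. v \<in> verts G) p"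
  shows "p \<in> verts G" "dist x p \<le> h"
proof -
  show "p \<in> verts G" using assms by (simp add: is_arg_min_def)
  obtain f where f: "f \<in> faces G" "x \<in> closure f" using faces_cover by blast
  obtain w where w: "w \<in> face_verts G f"
    using touching_faces_share_vertex[OF f(1,1), of "ctr f"] ctr(1)[OF f(1)] closure_subset[of f] by blast
  then have "w \<in> closure f" by (auto simp: face_verts_def frontier_def)
  then have "dist (ctr f) x \<le> h / 2" "dist (ctr f) w \<le> h / 2"
    using face_subset_cball[OF f(1)] f(2) by auto
  then have "dist x w \<le> h" using dist_triangle[of x w "ctr f"] by (simp add: dist_commute)
  moreover have "w \<in> verts G" using w by (simp add: face_verts_def)
  ultimately show "dist x p \<le> h" using assms by (auto simp: is_arg_min_def not_less intro: order.trans)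
qed

end

text \<open>A real infimum bounds the members from below only if the set is bounded below;
  nonnegativity of lengths provides this.\<close>

lemma isoradialI:
  assumes "0 < h" "isoradial_graph h G" "0 < c\<^sub>p" "0 < c\<^sub>d"
    and "c\<^sub>p * h \<le> (INF e\<in>edges G. edge_length e)"
    and "c\<^sub>d * h \<le> (INF e\<in>dual_edges G. edge_length e)"
  shows "isoradial G h c\<^sub>p c\<^sub>d"
proof
  have "\<exists>u v. e = {u, v}" if "e \<in> edges G" for e
    using assms(2) that unfolding isoradial_graph_def embedded_graph_def by meson
  then have "0 \<le> edge_length e" if "e \<in> edges G" for e
    using that by (metis edge_length_doubleton zero_le_dist)
  then have "bdd_below (edge_length ` edges G)" by (intro bdd_belowI[of _ 0]) auto
  then show "c\<^sub>p * h \<le> edge_length e" if "e \<in> edges G" for e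
    using assms(5) cINF_lower[OF _ that] by (meson order.trans)
  have "0 \<le> edge_length e" if "e \<in> dual_edges G" for e
    using that by (auto simp: dual_edges_def edge_length_doubleton)
  then have "bdd_below (edge_length ` dual_edges G)" by (intro bdd_belowI[of _ 0]) auto
  then show "c\<^sub>d * h \<le> edge_length e" if "e \<in> dual_edges G" for e
    using assms(6) cINF_lower[OF _ that] by (meson order.trans)
qed (use assms in auto)

theorem theorem4p1:
  fixes \<Gamma> :: "real \<Rightarrow> plane_graph"
    and proj :: "real \<Rightarrow> complex \<Rightarrow> complex"
    and c\<^sub>p c\<^sub>d \<beta> t :: real
    and x y :: complex
  assumes "\<And>h. h > 0 \<Longrightarrow> isoradial_graph h (\<Gamma> h)"
    and "c\<^sub>p > 0" and "c\<^sub>d > 0"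
    and "\<And>h. h > 0 \<Longrightarrow> c\<^sub>p * h \<le> (INF e\<in>edges (\<Gamma> h). edge_length e)"
    and "\<And>h. h > 0 \<Longrightarrow> c\<^sub>d * h \<le> (INF e\<in>dual_edges (\<Gamma> h). edge_length e)"
    and "\<And>h z. h > 0 \<Longrightarrow> is_arg_min (dist z) (\<lambda>v. v \<in> verts (\<Gamma> h)) (proj h z)"
    and "\<beta> > 1" and "t > 0"
  shows "((\<lambda>h. h / ln (h powr (\<beta> - 1)) *
              ln (heat_kernel (\<Gamma> h) (h powr \<beta> * t) (proj h x) (proj h y))
            - h * real (graph_dist (\<Gamma> h) (proj h x) (proj h y))) \<longlongrightarrow> 0) (at_right 0)"
proof -
  let ?p = "\<lambda>h. heat_kernel (\<Gamma> h) (h powr \<beta> * t) (proj h x) (proj h y)"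
  let ?d = "\<lambda>h. real (graph_dist (\<Gamma> h) (proj h x) (proj h y))"
  have iso: "isoradial (\<Gamma> h) h c\<^sub>p c\<^sub>d" if "0 < h" for h
    using that assms by (intro isoradialI) auto
  have "\<exists>C. \<forall>h. 0 < h \<and> h < 1 \<longrightarrow> \<bar>h * ln (?p h) - h * ?d h * ((\<beta> - 1) * ln h)\<bar> \<le> C + 2 * h * \<bar>ln h\<bar>"
  proof -
    \<comment> \<open>Outside the locale \<open>packing\<close> depends on \<open>c\<^sub>p\<close>
      alone, so it is one constant for the whole family of graphs.\<close>
    let ?N = "isoradial.packing c\<^sub>p"
    \<comment> \<open>Each projection moves a point by at most \<open>h\<close>, and the distance
      estimate has a summand \<open>3 * h\<close>; as \<open>h < 1\<close>, together they contribute
      at most 5.\<close>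
    define Y where "Y = (dist x y + 5) * ?N 2 * ?N 1"
    let ?C = "Y * \<bar>ln (c\<^sub>d * c\<^sub>p / ?N 1 * (c\<^sub>d / (2 * pi)) * t)\<bar>
      + Y * \<bar>ln (?N 1 * exp 1 * (2 * ?N 1 / (pi * c\<^sub>p ^ 3)) * t)\<bar> + Y\<^sup>2
      + 2 * (2 * ?N 1 / (pi * c\<^sub>p ^ 3)) * t + 2 + \<bar>ln (pi * (c\<^sub>p / 2)\<^sup>2)\<bar> + \<bar>ln pi\<bar>"
    have "\<bar>h * ln (?p h) - h * ?d h * ((\<beta> - 1) * ln h)\<bar> \<le> ?C + 2 * h * \<bar>ln h\<bar>" if h: "0 < h" "h < 1" for h
    proof -
      interpret isoradial "\<Gamma> h" h c\<^sub>p c\<^sub>d by (rule iso[OF h(1)])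
      note px = nearest_vertex_dist[OF assms(6)[OF h(1), of x]]
        and py = nearest_vertex_dist[OF assms(6)[OF h(1), of y]]
      have "dist (proj h x) (proj h y) \<le> dist (proj h x) x + dist x (proj h y)" by (rule dist_triangle)
      moreover have "dist x (proj h y) \<le> dist x y + dist y (proj h y)" by (rule dist_triangle)
      ultimately have "dist (proj h x) (proj h y) + 3 * h \<le> dist x y + 5"
        using px(2) py(2) h by (simp add: dist_commute)
      then have "(dist (proj h x) (proj h y) + 3 * h) * packing 2 * packing 1 \<le> Y"
        unfolding Y_def using packing_nonneg by (intro mult_right_mono) auto
      then have "h * ?d h \<le> Y" using scaled_graph_dist_le[OF px(1) py(1)] by linarith
      then show ?thesis using heat_kernel_estimate[OF px(1) py(1) h(2) assms(7,8)] by blast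
    qed
    then show ?thesis by blast
  qed
  then obtain C where C: "\<And>h. 0 < h \<Longrightarrow> h < 1 \<Longrightarrow>
      \<bar>h * ln (?p h) - h * ?d h * ((\<beta> - 1) * ln h)\<bar> \<le> C + 2 * h * \<bar>ln h\<bar>" by blast
  \<comment> \<open>The quotient of \<open>C + 2 * h * \<bar>ln h\<bar>\<close> by
    \<open>\<bar>(\<beta> - 1) * ln h\<bar>\<close>, with \<open>ln h\<close> negative for
    \<open>h < 1\<close>.\<close>
  let ?g = "\<lambda>h. (2 * h - C / ln h) / (\<beta> - 1)"
  have "(?g \<longlongrightarrow> (2 * 0 - 0) / (\<beta> - 1)) (at_right 0)"
    using assms(7) tendsto_divide_0[OF tendsto_const filterlim_at_bot_imp_at_infinity[OF ln_at_0], of C]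
    by (intro tendsto_intros) auto
  then have g: "(?g \<longlongrightarrow> 0) (at_right 0)" by simp
  show ?thesis
  proof (rule Lim_null_comparison[OF _ g])
    have "eventually (\<lambda>h::real. h \<in> {0<..<1}) (at_right 0)" by (rule eventually_at_right_real) simp
    then show "eventually (\<lambda>h. norm (h / ln (h powr (\<beta> - 1)) * ln (?p h) - h * ?d h) \<le> ?g h) (at_right 0)"
    proof eventually_elim
      case (elim h)
      then have h: "0 < h" "h < 1" by auto
      let ?l = "(\<beta> - 1) * ln h"
      have l: "ln h < 0" using h by simp
      then have l': "?l < 0" using assms(7) by (simp add: mult_pos_neg)
      have "h / ln (h powr (\<beta> - 1)) * ln (?p h) - h * ?d h = (h * ln (?p h) - h * ?d h * ?l) / ?l"
        using h l' assms(7) by (simp add: ln_powr diff_divide_distrib)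
      then have "norm (h / ln (h powr (\<beta> - 1)) * ln (?p h) - h * ?d h) = \<bar>h * ln (?p h) - h * ?d h * ?l\<bar> / \<bar>?l\<bar>"
        by simp
      also have "\<dots> \<le> (C + 2 * h * \<bar>ln h\<bar>) / \<bar>?l\<bar>" using C[OF h] by (intro divide_right_mono) auto
      also have "\<dots> = ?g h" using l l' assms(7) by (simp add: abs_mult field_simps)
      finally show ?case .
    qed
  qed
qed

end
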